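(* Let $n\ge 3$. A word $\underline{u}=(u_1,\ldots,u_{2n})\in\{0,1\}^{2n}$ is realizable if and only if its signature is interlacing.
   Context: Let $n\ge 3$. Let $P_1,\ldots,P_n$ be $n$ distinct points on the unit circle of the complex plane, arranged in positive (counterclockwise) cyclic order. For $1\le i\le n$ let $L_i$ be the perpendicular bisector of the segment $[P_i,P_{i+1}]$ (indices modulo $n$); all these lines pass through the center of the circle. The points are assumed to be in generic position, meaning that the lines $L_1,\dots,L_n$ are pairwise distinct, no $P_j$ lies on any $L_i$, and the point $1$ of the circle lies on no $L_i$. The lines then divide the plane into $2n$ regions (open sectors), numbered $1,\ldots,2n$ in counterclockwise order, the first being the region containing $1$. Let $v_i$ be the number of points among $P_1,\ldots,P_n$ lying in the $i$th region. Each region contains at most one point, so $\underline v=(v_1,\ldots,v_{2n})\in\{0,1\}^{2n}$; it is called the occupancy word of $P_1,\ldots,P_n$. A word in $\{0,1\}^{2n}$ is called realizable if it is the occupancy word of some such collection of points in generic position. The signature of a word $\underline v\in\{0,1\}^{2n}$ is $\underline\sigma=(\sigma_1,\ldots,\sigma_n)\in\{0,1,2\}^n$ with $\sigma_i=v_i+v_{i+n}$ for $1\le i\le n$. For integers $N\ge1$ and $1\le i,j\le N$, define $I_N(i,j)=\{i+1,\ldots,j-1\}$ if $i<j$, and $I_N(i,j)=\{1,\ldots,j-1\}\cup\{i+1,\ldots,N\}$ if $i\ge j$ (so $I_N(i,i)=\{1,\ldots,N\}\setminus\{i\}$). A word $\underline s=(s_1,\ldots,s_n)\in\{0,1,2\}^n$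 is called interlacing if (1) there exist $1\le i,j\le n$ with $s_i=0$ and $s_j=2$; and (2) for every pair $(i,j)$ with $1\le i,j\le n$ (possibly $i=j$) such that $s_i=s_j=0$ and $s_k\ne0$ for all $k\in I_n(i,j)$, there exists a unique $k_0\in I_n(i,j)$ with $s_{k_0}=2$. *)

theory Defs
  imports "HOL-Analysis.Analysis"
begin

text \<open>
  Families indexed by \<open>1, \<dots>, m\<close>, words included, are functions on \<^typ>\<open>nat\<close> whose values
  outside \<open>{1..m}\<close> are irrelevant.
\<close>

definition ccw_on_circle :: "nat \<Rightarrow> (nat \<Rightarrow> complex) \<Rightarrow> bool" where
  "ccw_on_circle m z \<longleftrightarrow>
     (\<exists>\<theta>::nat \<Rightarrow> real. strict_mono_on {1..m} \<theta> \<and> \<theta> m < \<theta> 1 + 2 * pi \<and>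
        (\<forall>i\<in>{1..m}. z i = cis (\<theta> i)))"

definition perp_bisector :: "complex \<Rightarrow> complex \<Rightarrow> complex set" where
  "perp_bisector a b = {z. dist z a = dist z b}"

text \<open>For \<open>1 \<le> i \<le> n\<close>, the cyclic successor of \<open>i\<close> in \<open>{1..n}\<close> is \<open>i mod n + 1\<close>.\<close>

definition bisector_line :: "nat \<Rightarrow> (nat \<Rightarrow> complex) \<Rightarrow> nat \<Rightarrow> complex set" where
  "bisector_line n P i = perp_bisector (P i) (P (i mod n + 1))"

definition generic_position :: "nat \<Rightarrow> (nat \<Rightarrow> complex) \<Rightarrow> bool" where
  "generic_position n P \<longleftrightarrow>
     inj_on (bisector_line n P) {1..n} \<and>
     (\<forall>i\<in>{1..n}. \<forall>j\<in>{1..n}. P j \<notin> bisector_line n P i) \<and>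
     (\<forall>i\<in>{1..n}. 1 \<notin> bisector_line n P i)"

definition regions :: "nat \<Rightarrow> (nat \<Rightarrow> complex) \<Rightarrow> complex set set" where
  "regions n P = components (- (\<Union>i\<in>{1..n}. bisector_line n P i))"

text \<open>
  The regions are open sectors with apex \<open>0\<close>, so their counterclockwise order is that of points
  of the unit circle chosen one in each of them, and does not depend on the choice. For points in
  generic position there is exactly one such numbering (up to its values outside \<open>{1..2 * n}\<close>).
\<close>

definition region_numbering :: "nat \<Rightarrow> (nat \<Rightarrow> complex) \<Rightarrow> (nat \<Rightarrow> complex set) \<Rightarrow> bool" where
  "region_numbering n P R \<longleftrightarrow>
     bij_betw R {1..2 * n} (regions n P) \<and> 1 \<in> R 1 \<and>
     (\<exists>w. ccw_on_circle (2 * n) w \<and> (\<forall>i\<in>{1..2 * n}. w i \<in> R i))"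

definition occupancy_word :: "nat \<Rightarrow> (nat \<Rightarrow> complex) \<Rightarrow> (nat \<Rightarrow> nat) \<Rightarrow> bool" where
  "occupancy_word n P v \<longleftrightarrow>
     (\<exists>R. region_numbering n P R \<and>
        (\<forall>i\<in>{1..2 * n}. v i = card {j\<in>{1..n}. P j \<in> R i}))"

definition realizable :: "nat \<Rightarrow> (nat \<Rightarrow> nat) \<Rightarrow> bool" where
  "realizable n v \<longleftrightarrow>
     (\<exists>P. ccw_on_circle n P \<and> generic_position n P \<and> occupancy_word n P v)"

definition word_signature :: "nat \<Rightarrow> (nat \<Rightarrow> nat) \<Rightarrow> nat \<Rightarrow> nat" where
  "word_signature n v i = v i + v (i + n)"

definition cyclic_between :: "nat \<Rightarrow> nat \<Rightarrow> nat \<Rightarrow> nat set" where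
  "cyclic_between N i j = (if i < j then {i<..<j} else {1..<j} \<union> {i<..N})"

definition interlacing :: "nat \<Rightarrow> (nat \<Rightarrow> nat) \<Rightarrow> bool" where
  "interlacing n s \<longleftrightarrow>
     (\<exists>i\<in>{1..n}. \<exists>j\<in>{1..n}. s i = 0 \<and> s j = 2) \<and>
     (\<forall>i\<in>{1..n}. \<forall>j\<in>{1..n}.
        s i = 0 \<and> s j = 0 \<and> (\<forall>k\<in>cyclic_between n i j. s k \<noteq> 0) \<longrightarrow>
        (\<exists>!k. k \<in> cyclic_between n i j \<and> s k = 2))"

end

(*
  Modulo a half turn, the points and the lines lie on a circle of length pi. Along the full circle
  the points alternate with the rays bisecting the arcs between consecutive points. Hence, adding
  up both sides of the half-turn circle, (number of points passed) - (number of lines passed), taken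
  just after a line, is a level in {0, 1}, which rises at the letters 2 of the signature and drops at
  the letters 0; so these letters alternate. They do occur: a constant level would put the arcs from
  each point to the next bisecting ray (or from each bisecting ray to the next point), of total
  length pi, strictly inside distinct gaps between the lines, of total length pi.

  Conversely, group the letters of an interlacing signature into clusters, each consisting of a
  letter 2 and the letters 1 around it. Place the points of a cluster at exponentially growing
  distances from the two points of the letter 2, and the clusters far apart. A midpoint of consecutive
  points then falls into the gap before the later point if that lies right of the cluster centre,
  into the gap after the earlier point if that lies left of it, and halfway between two clusters
  otherwise.
*)

theory Submission
  imports Defs
begin

section \<open>Periodic sequences\<close>

text \<open>Cyclic order is handled by unrolling: the angles of the points, of the bisecting rays
  and of the lines become increasing sequences on the integers that gain 2*pi or pi every n steps.
  No index wraps around, and a number of objects passed is a difference of two values of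
  \<open>idx\<close>. The obstacle in the converse is the distinctness of the lines. At a letter 0
  two consecutive lines enclose regions without points, so no point keeps them apart. They coincide
  only if the last points of the two strands before the letter 0 are exactly as far apart as the
  first ones after it. Distances from a cluster centre are therefore powers of 4 on its right but
  twice powers of 4 on its left: a gap at a right end lies between 3 * 4^d and 4 * 4^d, one at a
  left end between 6 * 4^d and 8 * 4^d + 1, and such ranges never meet. If the end of the cluster is
  the letter 2 itself, the gap is below 1 and encodes the position of the letter modulo n. Two
  letters 2 around a letter 0 then differ because n does not divide 2, which is where n \<ge> 3
  enters.\<close>

definition res :: "nat \<Rightarrow> int \<Rightarrow> nat" where
  "res N k = nat ((k - 1) mod int N) + 1"

lemma res_in: "N > 0 \<Longrightarrow> res N k \<in> {1..N}"
  unfolding res_def by (simp add: Suc_leI nat_less_iff)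

lemma res_of_nat: "i \<in> {1..N} \<Longrightarrow> res N (int i) = i"
  unfolding res_def by (auto simp: mod_pos_pos_trivial)

lemma res_add_mult [simp]: "res N (k + m * int N) = res N k"
  unfolding res_def by (simp add: diff_add_eq[symmetric])

lemma res_add [simp]: "res N (k + int N) = res N k"
  using res_add_mult[of N k 1] by simp

lemma int_res: "N > 0 \<Longrightarrow> int (res N k) = k - int N * ((k - 1) div int N)"
proof -
  assume "N > 0"
  then have "int (res N k) = (k - 1) mod int N + 1" unfolding res_def by simp
  then show ?thesis using mult_div_mod_eq[of "int N" "k - 1"] by linarith
qed

lemma res_eq_iff: "N > 0 \<Longrightarrow> res N a = res N b \<longleftrightarrow> a mod int N = b mod int N"
proof -
  assume N: "N > 0"
  have "res N a = res N b \<longleftrightarrow> (a - 1) mod int N = (b - 1) mod int N"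
    unfolding res_def using N by (auto simp: nat_eq_iff)
  also have "\<dots> \<longleftrightarrow> a mod int N = b mod int N"
    by (simp add: mod_eq_dvd_iff)
  finally show ?thesis .
qed

text \<open>Unrolls a family on \<open>1..N\<close> over all integers, gaining \<open>c\<close> per
  turn, so that cyclic neighbours become consecutive. The type is general because real angles and
  integer region numbers are both unrolled.\<close>

definition periodic_ext :: "nat \<Rightarrow> 'a::linordered_idom \<Rightarrow> (nat \<Rightarrow> 'a) \<Rightarrow> int \<Rightarrow> 'a" where
  "periodic_ext N c f k = f (res N k) + c * of_int ((k - 1) div int N)"

lemma periodic_ext_add:
  "N > 0 \<Longrightarrow> periodic_ext N c f (k + int N) = periodic_ext N c f k + c"
proof -
  assume "N > 0"
  then have "(k + int N - 1) div int N = (k - 1) div int N + 1"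
    using div_add_self2[of "int N" "k - 1"] by (simp add: algebra_simps)
  then show ?thesis unfolding periodic_ext_def by (simp add: distrib_left)
qed

lemma periodic_ext_of_nat: "i \<in> {1..N} \<Longrightarrow> periodic_ext N c f (int i) = f i"
  unfolding periodic_ext_def by (simp add: res_of_nat div_pos_pos_trivial)

lemma strict_mono_intI:
  fixes T :: "int \<Rightarrow> 'a::order"
  assumes "\<And>k. T k < T (k + 1)"
  shows "strict_mono T"
proof (rule strict_monoI)
  fix a b :: int
  assume "a < b"
  then show "T a < T b"
  proof (induction b rule: int_gr_induct)
    case base
    then show ?case using assms by simp
  next
    case (step i)
    then show ?case using assms[of i] by (meson less_trans)
  qed
qed

lemma strict_mono_periodic_ext:
  assumes N: "N > 0" and f: "strict_mono_on {1..N} f" and wrap: "f N < f 1 + c"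
  shows "strict_mono (periodic_ext N c f)"
proof (rule strict_mono_intI)
  fix k :: int
  let ?m = "(k - 1) mod int N" and ?d = "(k - 1) div int N"
  have k: "k = 1 + ?m + int N * ?d"
    by simp
  have m: "0 \<le> ?m" "?m < int N"
    using N by auto
  show "periodic_ext N c f k < periodic_ext N c f (k + 1)"
  \<comment> \<open>Only the step from index N to index 1 of the next turn changes the quotient; it
    rests on \<open>wrap\<close>.\<close>
  proof (cases "?m = int N - 1")
    case True
    then have k': "k = int N * (?d + 1)"
      using k by (simp add: algebra_simps)
    have 1: "k mod int N = 0"
      by (rule int_mod_pos_eq[of _ _ "?d + 1"]) (use k' N in auto)
    have 2: "k div int N = ?d + 1"
      by (rule int_div_pos_eq[of _ _ _ 0]) (use k' N in auto)
    have "res N k = N" "res N (k + 1) = 1"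
      unfolding res_def using True 1 N by auto
    then show ?thesis
      unfolding periodic_ext_def using wrap 2 by (simp add: algebra_simps)
  next
    case False
    have k': "k = int N * ?d + (1 + ?m)" using k by simp
    have 1: "k mod int N = 1 + ?m"
      by (rule int_mod_pos_eq[OF k']) (use False m in auto)
    have 2: "k div int N = ?d"
      by (rule int_div_pos_eq[OF k']) (use False m in auto)
    have "res N (k + 1) = res N k + 1"
      unfolding res_def using m 1 by simp
    moreover have "res N k \<in> {1..N}" "res N (k + 1) \<in> {1..N}"
      using res_in[OF N] by auto
    ultimately have "f (res N k) < f (res N (k + 1))"
      using f by (auto intro: strict_mono_onD)
    then show ?thesis
      unfolding periodic_ext_def using 2 by simp
  qed
qed

text \<open>Common frame for the unrolled angles of points and bisecting rays (c = 2*pi), of lines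
  (c = pi), and for the line positions of the construction (c = \<open>W\<close>).\<close>

locale periodic_seq =
  fixes T :: "int \<Rightarrow> real" and N :: nat and c :: real
  assumes N_pos: "N > 0"
    and mono: "strict_mono T"
    and period: "T (j + int N) = T j + c"
begin

lemma less_iff [simp]: "T i < T j \<longleftrightarrow> i < j"
  using mono by (rule strict_mono_less)

lemma le_iff [simp]: "T i \<le> T j \<longleftrightarrow> i \<le> j"
  using mono by (rule strict_mono_less_eq)

lemma eq_iff [simp]: "T i = T j \<longleftrightarrow> i = j"
  using mono by (rule strict_mono_eq)

lemma c_pos: "c > 0"
proof -
  have "T 0 < T (0 + int N)" using N_pos by simp
  then show ?thesis unfolding period by simp
qed

lemma period_mult: "T (j + m * int N) = T j + of_int m * c"
proof (induction m rule: int_induct[where k = 0])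
  case (step1 i)
  have "T (j + (i + 1) * int N) = T ((j + i * int N) + int N)" by (simp add: algebra_simps)
  then show ?case unfolding period using step1 by (simp add: algebra_simps)
next
  case (step2 i)
  have "T (j + i * int N) = T ((j + (i - 1) * int N) + int N)" by (simp add: algebra_simps)
  then show ?case unfolding period using step2 by (simp add: algebra_simps)
qed simp

lemma ex_idx: "\<exists>j. T j \<le> x \<and> x < T (j + 1)"
proof -
  define a where "a = \<lfloor>(x - T 0) / c\<rfloor> * int N"
  define b where "b = (\<lfloor>(x - T 0) / c\<rfloor> + 1) * int N"
  have "of_int \<lfloor>(x - T 0) / c\<rfloor> * c \<le> x - T 0"
    using c_pos by (simp flip: pos_le_divide_eq)
  then have a: "T a \<le> x"
    using period_mult[of 0 "\<lfloor>(x - T 0) / c\<rfloor>"] unfolding a_def by simp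
  have "x - T 0 < of_int (\<lfloor>(x - T 0) / c\<rfloor> + 1) * c"
    unfolding pos_divide_less_eq[OF c_pos, symmetric] by (simp add: floor_less_iff)
  then have b: "x < T b"
    using period_mult[of 0 "\<lfloor>(x - T 0) / c\<rfloor> + 1"] unfolding b_def by simp
  let ?S = "{j\<in>{a..b}. T j \<le> x}"
  have "a \<le> b" using a b less_iff[of a b] by linarith
  have "finite ?S" by (rule finite_subset[of _ "{a..b}"]) auto
  then have S: "finite ?S" "?S \<noteq> {}" using a \<open>a \<le> b\<close> by auto
  then have M: "Max ?S \<in> ?S" by (rule Max_in)
  moreover have "x < T (Max ?S + 1)"
  proof (rule ccontr)
    assume H: "\<not> x < T (Max ?S + 1)"
    have "T (Max ?S) \<le> x" using M by blast
    then have "T (Max ?S) < T b" using b by (rule le_less_trans)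
    then have "Max ?S < b" by simp
    then have "Max ?S + 1 \<in> ?S" using M H by auto
    then have "Max ?S + 1 \<le> Max ?S" using S by (intro Max_ge) auto
    then show False by simp
  qed
  ultimately show ?thesis by blast
qed

text \<open>A counting function: its increments count the terms in half-open intervals, and it
  generalizes the floor, the case where \<open>T\<close> is the inclusion of the integers.\<close>

definition idx :: "real \<Rightarrow> int" where
  "idx x = (SOME j. T j \<le> x \<and> x < T (j + 1))"

lemma idx: "T (idx x) \<le> x" "x < T (idx x + 1)"
  unfolding idx_def using someI_ex[OF ex_idx[of x]] by auto

lemma le_idx_iff: "T j \<le> x \<longleftrightarrow> j \<le> idx x"
  using idx[of x] less_iff[of j "idx x + 1"] le_iff[of j "idx x"] by linarith

lemma less_idx_iff: "x < T j \<longleftrightarrow> idx x < j"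
  using le_idx_iff[of j x] by linarith

lemma idx_eqI: "T j \<le> x \<Longrightarrow> x < T (j + 1) \<Longrightarrow> idx x = j"
  unfolding le_idx_iff less_idx_iff by simp

lemma idx_self [simp]: "idx (T j) = j"
  by (rule idx_eqI) auto

lemma idx_add: "idx (x + c) = idx x + int N"
proof (rule idx_eqI)
  show "T (idx x + int N) \<le> x + c" using idx[of x] period by simp
  have "T (idx x + int N + 1) = T (idx x + 1) + c" using period[of "idx x + 1"] by (simp add: algebra_simps)
  then show "x + c < T (idx x + int N + 1)" using idx[of x] by simp
qed

text \<open>The difference of indices counts the terms in the half-open interval from
  \<open>a\<close> (excluded) to \<open>b\<close> (included); it fits the open interval because
  \<open>b\<close> is not a term.\<close>

lemma card_Ioo:
  assumes "a < b" and "b \<notin> range T"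
  shows "int (card {j. a < T j \<and> T j < b}) = idx b - idx a"
proof -
  have "{j. a < T j \<and> T j < b} = {idx a <.. idx b}"
  proof (intro set_eqI iffI; clarsimp)
    fix j assume "a < T j" "T j < b"
    then show "idx a < j \<and> j \<le> idx b"
      using le_idx_iff[of j b] less_idx_iff[of a j] by simp
  next
    fix j assume "idx a < j" "j \<le> idx b"
    then show "a < T j \<and> T j < b"
      using le_idx_iff[of j b] less_idx_iff[of a j] assms(2) by (metis order_le_less rangeI)
  qed
  moreover have "idx a \<le> idx b"
    using idx(1)[of a] assms(1) le_idx_iff[of "idx a" b] by simp
  ultimately show ?thesis by simp
qed

end

lemma periodic_seq_ext:
  assumes "N > 0" "strict_mono_on {1..N} f" "f N < f 1 + c"
  shows "periodic_seq (periodic_ext N c f) N c"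
  using assms by unfold_locales (auto intro: strict_mono_periodic_ext simp: periodic_ext_add)

section \<open>Lines through the origin and sectors\<close>

text \<open>The whole line through 0 in direction \<open>m\<close>, both rays: turning it by
  \<open>- m\<close> gives the real axis. It depends on \<open>m\<close> only modulo pi.\<close>

definition ray_line :: "real \<Rightarrow> complex set" where
  "ray_line m = {z. Im (z * cis (- m)) = 0}"

text \<open>As an intersection of two open half-planes it is visibly open and convex. It is the
  sector of angles between \<open>a\<close> and \<open>b\<close> provided that
  \<open>a < b < a + pi\<close>.\<close>

definition sector :: "real \<Rightarrow> real \<Rightarrow> complex set" where
  "sector a b = {z. Im (z * cis (- a)) > 0 \<and> Im (z * cis (- b)) < 0}"

lemma Im_polar: "Im (of_real r * cis t * cis (- a)) = r * sin (t - a)"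
  by (simp add: mult.assoc cis_mult)

lemma polar_mem_ray_line:
  "r \<noteq> 0 \<Longrightarrow> of_real r * cis t \<in> ray_line m \<longleftrightarrow> sin (t - m) = 0"
  unfolding ray_line_def mem_Collect_eq Im_polar by simp

lemma cis_mem_ray_line: "cis t \<in> ray_line m \<longleftrightarrow> sin (t - m) = 0"
  using polar_mem_ray_line[of 1 t m] by simp

lemma ray_line_eq_iff: "ray_line a = ray_line b \<longleftrightarrow> sin (a - b) = 0"
proof
  assume "ray_line a = ray_line b"
  then have "cis a \<in> ray_line b" using cis_mem_ray_line[of a a] by simp
  then show "sin (a - b) = 0" by (simp add: cis_mem_ray_line)
next
  assume "sin (a - b) = 0"
  then obtain i :: int where i: "a - b = of_int i * pi" unfolding sin_zero_iff_int2 by blast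
  have c: "cis (- b) = cis (- a) * of_real (cos (a - b))"
  proof -
    have "cos (a - (a - b)) = cos a * cos (a - b)" "sin (a - (a - b)) = sin a * cos (a - b)"
      using \<open>sin (a - b) = 0\<close> by (simp_all only: cos_diff[of a "a - b"] sin_diff[of a "a - b"])
    then show ?thesis by (simp add: complex_eq_iff)
  qed
  have "cos (a - b) \<noteq> 0" using \<open>sin (a - b) = 0\<close> sin_zero_abs_cos_one by fastforce
  then show "ray_line a = ray_line b"
    unfolding ray_line_def c by (simp add: mult.assoc[symmetric] del: mult.assoc)
qed

text \<open>After turning by the mean angle \<open>m\<close>, the two points are symmetric about the
  real axis, and the difference of the squared distances is a nonzero multiple of
  \<open>sin d\<close> times the height of z. Distinctness of the points gives
  \<open>sin d \<noteq> 0\<close>.\<close>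

lemma perp_bisector_cis:
  assumes "cis a \<noteq> cis b"
  shows "perp_bisector (cis a) (cis b) = ray_line ((a + b) / 2)"
proof -
  define m d where "m = (a + b) / 2" and "d = (a - b) / 2"
  have ab: "a = m + d" "b = m - d" unfolding m_def d_def by (simp_all add: field_simps)
  have "sin d \<noteq> 0"
  proof
    assume "sin d = 0"
    then have "cis a = cis b" unfolding ab by (simp add: complex_eq_iff sin_add sin_diff cos_add cos_diff)
    with assms show False ..
  qed
  have "z \<in> perp_bisector (cis a) (cis b) \<longleftrightarrow> z \<in> ray_line m" for z
  proof -
    have D: "(dist z (cis t))\<^sup>2 = (Re z)\<^sup>2 + (Im z)\<^sup>2 + 1 - 2 * (Re z * cos t + Im z * sin t)" for t
      unfolding dist_norm cmod_power2 using sin_cos_squared_add[of t]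
      by (simp add: power2_diff algebra_simps)
    have "z \<in> perp_bisector (cis a) (cis b) \<longleftrightarrow> (dist z (cis a))\<^sup>2 = (dist z (cis b))\<^sup>2"
      unfolding perp_bisector_def by simp
    also have "\<dots> \<longleftrightarrow> Re z * cos a + Im z * sin a - (Re z * cos b + Im z * sin b) = 0"
      unfolding D by auto
    also have "Re z * cos a + Im z * sin a - (Re z * cos b + Im z * sin b)
               = 2 * sin d * (Im (z * cis (- m)))"
      unfolding ab by (simp add: sin_add sin_diff cos_add cos_diff algebra_simps)
    also have "\<dots> = 0 \<longleftrightarrow> z \<in> ray_line m"
      unfolding ray_line_def using \<open>sin d \<noteq> 0\<close> by simp
    finally show ?thesis .
  qed
  then show ?thesis unfolding m_def by blast
qed

lemma open_sector: "open (sector a b)"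
proof -
  have "sector a b = {z. 0 < Im (z * cis (- a))} \<inter> {z. Im (z * cis (- b)) < 0}"
    unfolding sector_def by blast
  then show ?thesis
    by (simp only:) (intro open_Int open_Collect_less continuous_intros)
qed

lemma connected_sector: "connected (sector a b)"
proof -
  have "convex (sector a b)"
  proof (rule convexI)
    fix x y :: complex and u v :: real
    assume xy: "x \<in> sector a b" "y \<in> sector a b" and uv: "0 \<le> u" "0 \<le> v" "u + v = 1"
    have *: "u * p + v * q > 0" if "p > 0" "q > 0" for p q :: real
      using convex_bound_lt[of "- p" 0 "- q" u v] that uv by simp
    have **: "u * p + v * q < 0" if "p < 0" "q < 0" for p q :: real
      using *[of "- p" "- q"] that by simp
    have Im: "Im ((u *\<^sub>R x + v *\<^sub>R y) * c) = u * Im (x * c) + v * Im (y * c)" for c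
      by (simp add: algebra_simps)
    show "u *\<^sub>R x + v *\<^sub>R y \<in> sector a b"
      using xy *[of "Im (x * cis (- a))" "Im (y * cis (- a))"]
        **[of "Im (x * cis (- b))" "Im (y * cis (- b))"]
      unfolding sector_def mem_Collect_eq Im by blast
  qed
  then show ?thesis by (rule convex_connected)
qed

lemma polar_mem_sector:
  assumes "r > 0" "a < b" "b < a + pi"
  shows "of_real r * cis t \<in> sector a b \<longleftrightarrow> (\<exists>m::int. a < t + 2 * pi * m \<and> t + 2 * pi * m < b)"
proof
  assume "of_real r * cis t \<in> sector a b"
  then have s: "sin (t - a) > 0" "sin (t - b) < 0"
    unfolding sector_def mem_Collect_eq Im_polar using \<open>r > 0\<close>
    by (simp_all add: zero_less_mult_iff mult_less_0_iff)
  \<comment> \<open>Chosen so that the representative \<open>t'\<close> of the angle lies in the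
    full turn starting at \<open>a\<close>; there the signs of the two sines locate it.\<close>
  define m where "m = - \<lfloor>(t - a) / (2 * pi)\<rfloor>"
  define t' where "t' = t + 2 * pi * m"
  have sin_eq: "sin (t' - x) = sin (t - x)" for x
    using sin.plus_of_int[of "t - x" m] unfolding t'_def by (simp add: algebra_simps)
  have "of_int (- m) * (2 * pi) \<le> t - a"
    unfolding m_def by (simp flip: pos_le_divide_eq)
  moreover have "t - a < of_int (- m + 1) * (2 * pi)"
    unfolding m_def by (subst pos_divide_less_eq[symmetric]) (simp_all add: floor_less_iff)
  ultimately have t': "0 \<le> t' - a" "t' - a < 2 * pi"
    unfolding t'_def by (simp_all add: algebra_simps)
  have "t' - a < pi"
  proof (rule ccontr)
    assume "\<not> t' - a < pi"
    then have "sin (t' - a) \<le> 0" using t' by (intro sin_le_zero) auto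
    with s show False by (simp add: sin_eq)
  qed
  moreover have "t' - a \<noteq> 0" using s(1) sin_eq[of a] by auto
  moreover have "t' < b"
  proof (rule ccontr)
    assume "\<not> t' < b"
    then have "sin (t' - b) \<ge> 0" using \<open>t' - a < pi\<close> assms by (intro sin_ge_zero) auto
    with s show False by (simp add: sin_eq)
  qed
  ultimately show "\<exists>m::int. a < t + 2 * pi * m \<and> t + 2 * pi * m < b"
    using t' unfolding t'_def by (intro exI[of _ m]) auto
next
  assume "\<exists>m::int. a < t + 2 * pi * m \<and> t + 2 * pi * m < b"
  then obtain m :: int where m: "a < t + 2 * pi * m" "t + 2 * pi * m < b" by blast
  define t' where "t' = t + 2 * pi * m"
  have sin_eq: "sin (t' - x) = sin (t - x)" for x
    using sin.plus_of_int[of "t - x" m] unfolding t'_def by (simp add: algebra_simps)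
  have "sin (t' - a) > 0" using m assms unfolding t'_def by (intro sin_gt_zero) auto
  moreover have "sin (b - t') > 0" using m assms unfolding t'_def by (intro sin_gt_zero) auto
  then have "sin (t' - b) < 0" using sin_minus[of "b - t'"] by simp
  ultimately show "of_real r * cis t \<in> sector a b"
    unfolding sector_def mem_Collect_eq Im_polar sin_eq using \<open>r > 0\<close>
    by (simp add: zero_less_mult_iff mult_less_0_iff)
qed

text \<open>A component meeting two members would be disconnected by one member and the union of the
  others, both open.\<close>

lemma components_disjoint_open:
  fixes F :: "'a::topological_space set set"
  assumes "\<And>C. C \<in> F \<Longrightarrow> open C \<and> connected C \<and> C \<noteq> {}" and "disjoint F"
  shows "components (\<Union>F) = F"
proof -
  have *: "connected_component_set (\<Union>F) x = C" if "C \<in> F" "x \<in> C" for C x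
  proof
    show "C \<subseteq> connected_component_set (\<Union>F) x"
      using that assms(1) by (intro connected_component_maximal) auto
    show "connected_component_set (\<Union>F) x \<subseteq> C"
    proof (rule ccontr)
      let ?D = "connected_component_set (\<Union>F) x"
      assume H: "\<not> ?D \<subseteq> C"
      have D: "?D \<subseteq> \<Union>F" by (rule connected_component_subset)
      have "open C" "open (\<Union>(F - {C}))" using assms(1) that by auto
      moreover have "C \<inter> \<Union>(F - {C}) = {}"
        using assms(2) that unfolding disjoint_def by auto
      moreover have "?D \<subseteq> C \<union> \<Union>(F - {C})" using D by auto
      moreover have "C \<inter> ?D \<noteq> {}"
        using that connected_component_refl[of x "\<Union>F"] by blast
      moreover have "\<Union>(F - {C}) \<inter> ?D \<noteq> {}" using H D by auto
      ultimately show False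
        using connectedD[OF connected_connected_component[of "\<Union>F" x], of C "\<Union>(F - {C})"] by auto
    qed
  qed
  show ?thesis
  proof
    show "components (\<Union>F) \<subseteq> F" unfolding components_def using * by auto
    show "F \<subseteq> components (\<Union>F)"
    proof
      fix C assume C: "C \<in> F"
      then obtain x where "x \<in> C" using assms(1) by blast
      with *[OF C this] C show "C \<in> components (\<Union>F)" unfolding components_def by blast
    qed
  qed
qed

section \<open>The regions and their numbering\<close>

locale circle_points = T: periodic_seq T n "2 * pi" for T :: "int \<Rightarrow> real" and n :: nat +
  fixes P :: "nat \<Rightarrow> complex"
  assumes n_gt_1: "n > 1"
    and P_eq: "i \<in> {1..n} \<Longrightarrow> P i = cis (T (int i))"
begin

text \<open>The direction bisecting the counterclockwise arc from one point to the next, also when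
  this arc exceeds a half turn. The other ray of the same line has angle
  \<open>\<mu> j + pi\<close>.\<close>

definition \<mu> :: "int \<Rightarrow> real" where
  "\<mu> j = (T j + T (j + 1)) / 2"

lemma \<mu>_add_mult: "\<mu> (j + m * int n) = \<mu> j + of_int m * (2 * pi)"
  using T.period_mult[of j m] T.period_mult[of "j + 1" m] unfolding \<mu>_def
  by (simp add: add_ac add_divide_distrib)

lemma \<mu>: "T j < \<mu> j" "\<mu> j < T (j + 1)"
  using T.less_iff[of j "j + 1"] unfolding \<mu>_def by auto

lemma periodic_\<mu>: "periodic_seq \<mu> n (2 * pi)"
proof
  show "strict_mono \<mu>"
  proof (rule strict_mono_intI)
    show "\<mu> k < \<mu> (k + 1)" for k using \<mu>[of k] \<mu>[of "k + 1"] by simp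
  qed
  show "\<mu> (j + int n) = \<mu> j + 2 * pi" for j using \<mu>_add_mult[of j 1] by simp
qed (use T.N_pos in simp)

sublocale M: periodic_seq \<mu> n "2 * pi"
  by (rule periodic_\<mu>)

lemma cis_T_ne: "cis (T j) \<noteq> cis (T (j + 1))"
proof
  assume "cis (T j) = cis (T (j + 1))"
  then have "sin (T j) = sin (T (j + 1)) \<and> cos (T j) = cos (T (j + 1))"
    by (simp add: complex_eq_iff)
  then obtain m :: int where "T j = T (j + 1) + 2 * pi * of_int m"
    unfolding sin_cos_eq_iff by blast
  then have "T j = T (j + 1 + m * int n)" unfolding T.period_mult by simp
  then have "j = j + 1 + m * int n" unfolding T.eq_iff .
  then have "int n dvd 1" by (intro dvdI[of _ _ "- m"]) (simp add: algebra_simps)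
  with n_gt_1 show False by simp
qed

lemma bisector_line: "i \<in> {1..n} \<Longrightarrow> bisector_line n P i = ray_line (\<mu> (int i))"
proof -
  assume i: "i \<in> {1..n}"
  have "P (i mod n + 1) = cis (T (int i + 1))"
  proof (cases "i = n")
    case True
    then have "P (i mod n + 1) = cis (T 1)" using P_eq[of 1] n_gt_1 by simp
    also have "\<dots> = cis (T 1 + 2 * pi)" by (simp add: cis_mult[symmetric])
    also have "T 1 + 2 * pi = T (int i + 1)" using T.period[of 1] True by (simp add: add_ac)
    finally show ?thesis .
  next
    case False
    then show ?thesis using i P_eq[of "i + 1"] by (simp add: add_ac)
  qed
  then show ?thesis
    unfolding bisector_line_def P_eq[OF i] \<mu>_def using perp_bisector_cis[OF cis_T_ne] by simp
qed

lemma ray_line_\<mu>_res: "ray_line (\<mu> (int (res n j))) = ray_line (\<mu> j)"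
proof -
  have "int (res n j) = j + (- ((j - 1) div int n)) * int n"
    using int_res[OF T.N_pos, of j] by simp
  then have "\<mu> (int (res n j)) - \<mu> j = of_int (- 2 * ((j - 1) div int n)) * pi"
    using \<mu>_add_mult[of j "- ((j - 1) div int n)"] by simp
  then show ?thesis unfolding ray_line_eq_iff sin_zero_iff_int2 by blast
qed

end

text \<open>The terms of \<open>\<alpha>\<close> are the angles of both rays of every line in
  increasing order; one line gives two terms, n indices apart. That there are n different lines is
  hidden in strict monotonicity with period n, and the signs at 0 and 1 put the point 1 into the
  first region.\<close>

locale circle_config = circle_points T n P + A: periodic_seq \<alpha> n pi
  for T \<alpha> :: "int \<Rightarrow> real" and n :: nat and P :: "nat \<Rightarrow> complex" +
  assumes \<alpha>_0: "\<alpha> 0 < 0" and \<alpha>_1: "0 < \<alpha> 1"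
    and mid_ray: "\<exists>k. \<mu> j = \<alpha> k"
    and ray_mid: "\<exists>j. \<exists>t::int. \<alpha> k = \<mu> j + of_int t * pi"
begin

lemma ray_line_\<alpha>_eq_iff: "ray_line (\<alpha> k) = ray_line (\<alpha> l) \<longleftrightarrow> k mod int n = l mod int n"
proof -
  have "ray_line (\<alpha> k) = ray_line (\<alpha> l) \<longleftrightarrow> (\<exists>i::int. \<alpha> k - \<alpha> l = of_int i * pi)"
    unfolding ray_line_eq_iff sin_zero_iff_int2 ..
  also have "\<dots> \<longleftrightarrow> (\<exists>i::int. \<alpha> k = \<alpha> (l + i * int n))"
    unfolding A.period_mult by (simp add: algebra_simps)
  also have "\<dots> \<longleftrightarrow> (\<exists>i::int. k = l + i * int n)" by simp
  also have "\<dots> \<longleftrightarrow> int n dvd (k - l)"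
    unfolding dvd_def by (auto simp: algebra_simps)
  finally show ?thesis by (simp add: mod_eq_dvd_iff)
qed

lemma bisector_lines: "bisector_line n P ` {1..n} = range (\<lambda>k. ray_line (\<alpha> k))"
proof
  show "bisector_line n P ` {1..n} \<subseteq> range (\<lambda>k. ray_line (\<alpha> k))"
  proof clarify
    fix i assume i: "i \<in> {1..n}"
    obtain k where "\<mu> (int i) = \<alpha> k" using mid_ray[of "int i"] by blast
    then show "bisector_line n P i \<in> range (\<lambda>k. ray_line (\<alpha> k))"
      unfolding bisector_line[OF i] by simp
  qed
  show "range (\<lambda>k. ray_line (\<alpha> k)) \<subseteq> bisector_line n P ` {1..n}"
  proof clarify
    fix k
    obtain j and t :: int where "\<alpha> k - \<mu> j = of_int t * pi"
      using ray_mid[of k] by (metis add_diff_cancel_left')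
    then have "ray_line (\<alpha> k) = ray_line (\<mu> j)"
      unfolding ray_line_eq_iff sin_zero_iff_int2 by blast
    also have "\<dots> = bisector_line n P (res n j)"
      using res_in[OF T.N_pos, of j] by (simp add: bisector_line ray_line_\<mu>_res)
    finally show "ray_line (\<alpha> k) \<in> bisector_line n P ` {1..n}"
      using res_in[OF T.N_pos, of j] by blast
  qed
qed

text \<open>The sequence \<open>\<alpha>\<close> provides n different lines, all of them bisectors,
  so the n bisectors cannot repeat.\<close>

lemma inj_on_bisector_line: "inj_on (bisector_line n P) {1..n}"
proof (rule eq_card_imp_inj_on)
  let ?L = "\<lambda>i::nat. ray_line (\<alpha> (int i))"
  have "inj_on ?L {1..n}"
  proof (rule inj_onI)
    fix i j assume "i \<in> {1..n}" "j \<in> {1..n}" "?L i = ?L j"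
    then show "i = j"
      using res_eq_iff[OF T.N_pos, of "int i" "int j"] by (simp add: ray_line_\<alpha>_eq_iff res_of_nat)
  qed
  then have "card (?L ` {1..n}) = n" by (simp add: card_image)
  moreover have "?L ` {1..n} \<subseteq> bisector_line n P ` {1..n}" unfolding bisector_lines by blast
  ultimately have "n \<le> card (bisector_line n P ` {1..n})"
    using card_mono[of "bisector_line n P ` {1..n}" "?L ` {1..n}"] by simp
  then show "card (bisector_line n P ` {1..n}) = card {1..n}"
    using card_image_le[of "{1..n}" "bisector_line n P"] by simp
qed simp

lemma cis_mem_lines_iff: "(\<exists>i\<in>{1..n}. cis t \<in> bisector_line n P i) \<longleftrightarrow> t \<in> range \<alpha>"
proof -
  have "(\<exists>i\<in>{1..n}. cis t \<in> bisector_line n P i) \<longleftrightarrow> (\<exists>k. cis t \<in> ray_line (\<alpha> k))"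
    using bisector_lines by (metis (no_types, lifting) imageE image_eqI rangeI)
  also have "\<dots> \<longleftrightarrow> t \<in> range \<alpha>"
  proof
    assume "\<exists>k. cis t \<in> ray_line (\<alpha> k)"
    then obtain k and i :: int where "t - \<alpha> k = of_int i * pi"
      unfolding cis_mem_ray_line sin_zero_iff_int2 by blast
    then have "t = \<alpha> (k + i * int n)" unfolding A.period_mult by simp
    then show "t \<in> range \<alpha>" by blast
  next
    assume "t \<in> range \<alpha>"
    then obtain k where "t = \<alpha> k" by blast
    then show "\<exists>k. cis t \<in> ray_line (\<alpha> k)" by (auto simp: cis_mem_ray_line intro!: exI[of _ k])
  qed
  finally show ?thesis .
qed

section \<open>The sectors between consecutive lines as the numbered regions\<close>

lemma \<alpha>_period2: "\<alpha> (k + m * (2 * int n)) = \<alpha> k + 2 * pi * of_int m"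
  using A.period_mult[of k "2 * m"] by (simp add: algebra_simps)

lemma \<alpha>_gap: "\<alpha> k < \<alpha> (k - 1) + pi"
  using A.period[of "k - 1"] A.less_iff[of k "k - 1 + int n"] n_gt_1 by simp

text \<open>Indexed by its upper end, so that \<open>\<alpha> 0 < 0 < \<alpha> 1\<close> makes
  \<open>sec 1\<close> the region of the point 1. Indices equal modulo 2n name the same
  region.\<close>

definition sec :: "int \<Rightarrow> complex set" where
  "sec k = sector (\<alpha> (k - 1)) (\<alpha> k)"

lemma polar_mem_sec:
  "r > 0 \<Longrightarrow> of_real r * cis t \<in> sec k \<longleftrightarrow>
    (\<exists>m::int. \<alpha> (k + m * (2 * int n) - 1) < t \<and> t < \<alpha> (k + m * (2 * int n)))"
  (is "_ \<Longrightarrow> _ = (\<exists>m. ?R m)")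
proof -
  assume "r > 0"
  then have "of_real r * cis t \<in> sec k \<longleftrightarrow>
      (\<exists>m::int. \<alpha> (k - 1) < t + 2 * pi * m \<and> t + 2 * pi * m < \<alpha> k)"
    unfolding sec_def using \<alpha>_gap by (intro polar_mem_sector) auto
  also have "\<dots> \<longleftrightarrow> (\<exists>m::int. ?R (- m))"
  proof (rule ex_cong1)
    fix m :: int
    have "\<alpha> (k + (- m) * (2 * int n) - 1) = \<alpha> (k - 1) + 2 * pi * of_int (- m)"
      using \<alpha>_period2[of "k - 1" "- m"] by (simp add: algebra_simps)
    then show "\<alpha> (k - 1) < t + 2 * pi * m \<and> t + 2 * pi * m < \<alpha> k \<longleftrightarrow> ?R (- m)"
      unfolding \<alpha>_period2[of k "- m"] by auto
  qed
  also have "\<dots> \<longleftrightarrow> (\<exists>m. ?R m)" by (metis minus_minus)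
  finally show ?thesis .
qed

lemma cis_mem_sec:
  "cis t \<in> sec k \<longleftrightarrow>
    (\<exists>m::int. \<alpha> (k + m * (2 * int n) - 1) < t \<and> t < \<alpha> (k + m * (2 * int n)))"
  using polar_mem_sec[of 1 t k] by simp

lemma between_unique:
  assumes "\<alpha> (k - 1) < t" "t < \<alpha> k" "\<alpha> (l - 1) < t" "t < \<alpha> l"
  shows "k = l"
  using A.less_iff[of "k - 1" l] A.less_iff[of "l - 1" k] assms by linarith

lemma sec_mod_eq: "sec k \<inter> sec l \<noteq> {} \<Longrightarrow> k mod (2 * int n) = l mod (2 * int n)"
proof -
  assume "sec k \<inter> sec l \<noteq> {}"
  then obtain z where z: "z \<in> sec k" "z \<in> sec l" by blast
  have "z \<noteq> 0" using z unfolding sec_def sector_def by auto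
  then obtain r t where rt: "r > 0" "z = of_real r * cis t"
    by (metis rcis_cmod_Arg rcis_def zero_less_norm_iff)
  obtain m m' :: int where
    "\<alpha> (k + m * (2 * int n) - 1) < t \<and> t < \<alpha> (k + m * (2 * int n))"
    "\<alpha> (l + m' * (2 * int n) - 1) < t \<and> t < \<alpha> (l + m' * (2 * int n))"
    using z rt polar_mem_sec by blast
  then have "k + m * (2 * int n) = l + m' * (2 * int n)" using between_unique by blast
  then show ?thesis by (metis mod_mult_self1)
qed

lemma mod_2n_eqD:
  "i \<in> {1..2 * n} \<Longrightarrow> j \<in> {1..2 * n} \<Longrightarrow> int i mod (2 * int n) = int j mod (2 * int n) \<Longrightarrow> i = j"
  using res_eq_iff[of "2 * n" "int i" "int j"] T.N_pos by (simp add: res_of_nat)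

lemma mid_mem_sec: "cis ((\<alpha> (k - 1) + \<alpha> k) / 2) \<in> sec k"
  unfolding cis_mem_sec using A.less_iff[of "k - 1" k] by (intro exI[of _ 0]) auto

lemma complement_lines:
  "- (\<Union>i\<in>{1..n}. bisector_line n P i) = (\<Union>i\<in>{1..2 * n}. sec (int i))"
proof (intro set_eqI)
  fix z
  show "z \<in> - (\<Union>i\<in>{1..n}. bisector_line n P i) \<longleftrightarrow> z \<in> (\<Union>i\<in>{1..2 * n}. sec (int i))"
  proof (cases "z = 0")
    case True
    have "bisector_line n P 1 = ray_line (\<mu> 1)" using bisector_line[of 1] n_gt_1 by simp
    then have "z \<in> bisector_line n P 1" using True by (simp add: ray_line_def)
    moreover have "1 \<in> {1..n}" using n_gt_1 by simp
    ultimately have "z \<notin> - (\<Union>i\<in>{1..n}. bisector_line n P i)" by blast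
    moreover have "z \<notin> (\<Union>i\<in>{1..2 * n}. sec (int i))"
      using True by (simp add: sec_def sector_def)
    ultimately show ?thesis by blast
  next
    case False
    then obtain r t where r: "r > 0" and z: "z = of_real r * cis t"
      by (metis rcis_cmod_Arg rcis_def zero_less_norm_iff)
    have "(\<exists>i\<in>{1..n}. z \<in> bisector_line n P i) \<longleftrightarrow> (\<exists>i\<in>{1..n}. cis t \<in> bisector_line n P i)"
      unfolding z using r polar_mem_ray_line by (simp add: bisector_line cis_mem_ray_line)
    also have "\<dots> \<longleftrightarrow> t \<in> range \<alpha>" by (rule cis_mem_lines_iff)
    finally have 1: "z \<in> - (\<Union>i\<in>{1..n}. bisector_line n P i) \<longleftrightarrow> t \<notin> range \<alpha>" by blast
    have 2: "z \<in> (\<Union>i\<in>{1..2 * n}. sec (int i)) \<longleftrightarrow> t \<notin> range \<alpha>"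
    proof
      assume "z \<in> (\<Union>i\<in>{1..2 * n}. sec (int i))"
      then obtain k where k: "\<alpha> (k - 1) < t" "t < \<alpha> k"
        unfolding z using r polar_mem_sec by blast
      show "t \<notin> range \<alpha>"
      proof
        assume "t \<in> range \<alpha>"
        then obtain l where "t = \<alpha> l" by blast
        with k show False by simp
      qed
    next
      assume t: "t \<notin> range \<alpha>"
      define k where "k = A.idx t + 1"
      have k: "\<alpha> (k - 1) < t" "t < \<alpha> k"
        using A.idx[of t] t unfolding k_def by (auto simp: order_le_less intro: rangeI dest: sym)
      have i: "res (2 * n) k \<in> {1..2 * n}" using T.N_pos by (intro res_in) simp
      have "int (res (2 * n) k) = k - int (2 * n) * ((k - 1) div int (2 * n))"
        using T.N_pos by (intro int_res) simp
      then have "k = int (res (2 * n) k) + ((k - 1) div int (2 * n)) * (2 * int n)"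
        by simp
      then have "z \<in> sec (int (res (2 * n) k))"
        unfolding z polar_mem_sec[OF r] using k by metis
      with i show "z \<in> (\<Union>i\<in>{1..2 * n}. sec (int i))" by blast
    qed
    show ?thesis unfolding 1 2 ..
  qed
qed

lemma regions_eq: "regions n P = (\<lambda>i. sec (int i)) ` {1..2 * n}"
  unfolding regions_def complement_lines
proof (rule components_disjoint_open)
  fix C assume "C \<in> (\<lambda>i. sec (int i)) ` {1..2 * n}"
  then obtain i :: nat where "C = sec (int i)" by blast
  then show "open C \<and> connected C \<and> C \<noteq> {}"
    using mid_mem_sec[of i] open_sector connected_sector unfolding sec_def by blast
next
  show "disjoint ((\<lambda>i. sec (int i)) ` {1..2 * n})"
  proof (rule disjointI)
    fix C D assume "C \<in> (\<lambda>i. sec (int i)) ` {1..2 * n}" "D \<in> (\<lambda>i. sec (int i)) ` {1..2 * n}" "C \<noteq> D"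
    then obtain i j where ij: "i \<in> {1..2 * n}" "j \<in> {1..2 * n}" "C = sec (int i)" "D = sec (int j)"
      by blast
    show "C \<inter> D = {}"
    proof (rule ccontr)
      assume "C \<inter> D \<noteq> {}"
      then have "sec (int i) \<inter> sec (int j) \<noteq> {}" using ij by simp
      from mod_2n_eqD[OF ij(1,2) sec_mod_eq[OF this]] ij \<open>C \<noteq> D\<close> show False by simp
    qed
  qed
qed

lemma inj_on_sec: "inj_on (\<lambda>i. sec (int i)) {1..2 * n}"
proof (rule inj_onI)
  fix i j :: nat
  assume ij: "i \<in> {1..2 * n}" "j \<in> {1..2 * n}" and "sec (int i) = sec (int j)"
  then have "sec (int i) \<inter> sec (int j) \<noteq> {}" using mid_mem_sec by blast
  from mod_2n_eqD[OF ij sec_mod_eq[OF this]] show "i = j" .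
qed

lemma one_mem_sec: "1 \<in> sec 1"
proof -
  have "cis 0 \<in> sec 1"
    unfolding cis_mem_sec using \<alpha>_0 \<alpha>_1 by (intro exI[of _ 0]) simp
  then show ?thesis by simp
qed

lemma region_numbering_sec: "region_numbering n P (\<lambda>i. sec (int i))"
  unfolding region_numbering_def
proof (intro conjI exI)
  show "bij_betw (\<lambda>i. sec (int i)) {1..2 * n} (regions n P)"
    unfolding regions_eq using inj_on_sec by (rule inj_on_imp_bij_betw)
  show "1 \<in> sec (int 1)" using one_mem_sec by simp
  let ?w = "\<lambda>i::nat. (\<alpha> (int i - 1) + \<alpha> (int i)) / 2"
  show "ccw_on_circle (2 * n) (\<lambda>i. cis (?w i))"
    unfolding ccw_on_circle_def
  proof (intro exI conjI ballI)
    show "strict_mono_on {1..2 * n} ?w"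
    proof (rule strict_mono_onI)
      fix r s :: nat assume "r < s"
      then have "\<alpha> (int r - 1) < \<alpha> (int s - 1)" "\<alpha> (int r) < \<alpha> (int s)" by simp_all
      then show "?w r < ?w s" by (intro divide_strict_right_mono add_strict_mono) simp_all
    qed
    have "\<alpha> (2 * int n) = \<alpha> 0 + 2 * pi" using \<alpha>_period2[of 0 1] by simp
    moreover have "\<alpha> (2 * int n - 1) < \<alpha> (2 * int n)" "\<alpha> 0 < \<alpha> 1" by simp_all
    ultimately have "\<alpha> (2 * int n - 1) + \<alpha> (2 * int n) < \<alpha> 0 + \<alpha> 1 + 4 * pi" by linarith
    moreover have "(a + b) / 2 < (c + d) / 2 + 2 * pi" if "a + b < c + d + 4 * pi" for a b c d :: real
      using that by (simp add: field_simps)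
    ultimately have "(\<alpha> (2 * int n - 1) + \<alpha> (2 * int n)) / 2 < (\<alpha> 0 + \<alpha> 1) / 2 + 2 * pi" by blast
    then show "?w (2 * n) < ?w 1 + 2 * pi" by simp
  qed simp
  show "\<forall>i\<in>{1..2 * n}. cis (?w i) \<in> sec (int i)" using mid_mem_sec by blast
qed

text \<open>Let \<open>I i\<close> be the unrolled number of the sector visited by the i-th sample
  point. These integers increase strictly, as \<open>R\<close> is injective, and gain less than 2n
  in all, as the samples stay within one turn; hence they are consecutive. The condition on the
  point 1 fixes where they start, modulo 2n.\<close>

lemma region_numbering_unique:
  assumes "region_numbering n P R" "i \<in> {1..2 * n}"
  shows "R i = sec (int i)"
proof -
  from assms(1) obtain w where bij: "bij_betw R {1..2 * n} (regions n P)" and R1: "1 \<in> R 1"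
    and w: "ccw_on_circle (2 * n) w" "\<And>i. i \<in> {1..2 * n} \<Longrightarrow> w i \<in> R i"
    unfolding region_numbering_def by blast
  obtain \<omega> where \<omega>: "strict_mono_on {1..2 * n} \<omega>" "\<omega> (2 * n) < \<omega> 1 + 2 * pi"
    "\<And>i. i \<in> {1..2 * n} \<Longrightarrow> w i = cis (\<omega> i)"
    using w(1) unfolding ccw_on_circle_def by blast
  define I where "I i = A.idx (\<omega> i) + 1" for i
  have I: "\<alpha> (I i - 1) < \<omega> i \<and> \<omega> i < \<alpha> (I i) \<and> R i = sec (int (res (2 * n) (I i)))"
    if i: "i \<in> {1..2 * n}" for i
  proof -
    have "R i \<in> regions n P" using bij i bij_betwE by blast
    then obtain j where j: "j \<in> {1..2 * n}" "R i = sec (int j)" unfolding regions_eq by blast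
    then have "cis (\<omega> i) \<in> sec (int j)" using w(2)[OF i] \<omega>(3)[OF i] by simp
    then obtain m where m: "\<alpha> (int j + m * (2 * int n) - 1) < \<omega> i"
      "\<omega> i < \<alpha> (int j + m * (2 * int n))" unfolding cis_mem_sec by blast
    have "A.idx (\<omega> i) = int j + m * (2 * int n) - 1"
      using m by (intro A.idx_eqI) auto
    then have "I i = int j + m * (2 * int n)" unfolding I_def by simp
    moreover from this have "res (2 * n) (I i) = j"
      using res_add_mult[of "2 * n" "int j" m] j(1) by (simp add: res_of_nat)
    ultimately show ?thesis using m j by simp
  qed
  have 2: "2 * n > 0" using T.N_pos by simp
  have I_inj: "i = j" if "i \<in> {1..2 * n}" "j \<in> {1..2 * n}" "res (2 * n) (I i) = res (2 * n) (I j)" for i j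
    using bij I[OF that(1)] I[OF that(2)] that unfolding bij_betw_def inj_on_def by metis
  have I_step: "I i + 1 \<le> I (i + 1)" if "1 \<le> i" "i < 2 * n" for i
  proof -
    have "\<omega> i < \<omega> (i + 1)" using \<omega>(1) that by (auto intro: strict_mono_onD)
    moreover have "\<alpha> (I i - 1) < \<omega> i" "\<omega> (i + 1) < \<alpha> (I (i + 1))"
      using I[of i] I[of "i + 1"] that by auto
    ultimately have "\<alpha> (I i - 1) < \<alpha> (I (i + 1))" by linarith
    then have "I i \<le> I (i + 1)" by simp
    moreover have "I i \<noteq> I (i + 1)" using I_inj[of i "i + 1"] that by force
    ultimately show ?thesis by simp
  qed
  have I_up: "I i + int (j - i) \<le> I j" if "1 \<le> i" "i \<le> j" "j \<le> 2 * n" for i j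
    using that(2,3)
  proof (induction j rule: dec_induct)
    case (step j)
    then show ?case using I_step[of j] that(1) by (simp add: of_nat_diff)
  qed simp
  have R1': "R 1 = sec 1"
  proof -
    have m1: "(1::nat) \<in> {1..2 * n}" using 2 by simp
    let ?j = "res (2 * n) (I 1)"
    have "1 \<in> sec (int ?j)" using R1 I[OF m1] by simp
    then have "sec (int ?j) \<inter> sec (int 1) \<noteq> {}" using one_mem_sec by auto
    from mod_2n_eqD[OF res_in[OF 2] m1 sec_mod_eq[OF this]] I[OF m1] show ?thesis by simp
  qed
  have "res (2 * n) (I 1) = 1"
  proof -
    have m1: "(1::nat) \<in> {1..2 * n}" using 2 by simp
    have "sec (int (res (2 * n) (I 1))) = sec (int 1)" using I[OF m1] R1' by simp
    from inj_onD[OF inj_on_sec this] res_in[OF 2] m1 show ?thesis by blast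
  qed
  define m where "m = (I 1 - 1) div int (2 * n)"
  have I1: "I 1 = 1 + m * int (2 * n)"
    using int_res[OF 2, of "I 1"] \<open>res (2 * n) (I 1) = 1\<close> unfolding m_def
    by (simp add: algebra_simps)
  have "I (2 * n) < I 1 + int (2 * n)"
  proof -
    have "\<alpha> (I (2 * n) - 1) < \<alpha> (I 1) + 2 * pi"
    proof -
      have "\<alpha> (I (2 * n) - 1) < \<omega> (2 * n)" "\<omega> 1 < \<alpha> (I 1)"
        using I[of "2 * n"] I[of 1] 2 by auto
      then show ?thesis using \<omega>(2) by linarith
    qed
    also have "\<dots> = \<alpha> (I 1 + int (2 * n))" using \<alpha>_period2[of "I 1" 1] by simp
    finally have "I (2 * n) \<le> I 1 + int (2 * n)" by simp
    moreover have "I (2 * n) \<noteq> I 1 + int (2 * n)"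
      using I_inj[of "2 * n" 1] res_add[of "2 * n" "I 1"] n_gt_1 by force
    ultimately show ?thesis by simp
  qed
  moreover have "I 1 + int (i - 1) \<le> I i" "I i + int (2 * n - i) \<le> I (2 * n)"
    using I_up[of 1 i] I_up[of i "2 * n"] assms(2) by auto
  ultimately have "I i = int i + m * int (2 * n)"
    using I1 assms(2) by (auto simp: of_nat_diff)
  then have "res (2 * n) (I i) = i" using assms(2) by (simp only: res_add_mult res_of_nat)
  then show ?thesis using I[OF assms(2)] by simp
qed

text \<open>The right side counts lifts of points in a single interval of angles. That interval is
  shorter than a full turn, so each point has at most one lift in it.\<close>

lemma card_points_sec:
  "card {j\<in>{1..n}. P j \<in> sec k} = card {j. \<alpha> (k - 1) < T j \<and> T j < \<alpha> k}"
proof -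
  let ?J = "{j. \<alpha> (k - 1) < T j \<and> T j < \<alpha> k}"
  have shift: "T (j + m * int n) = T j + 2 * pi * of_int m" for j m
    using T.period_mult by (simp add: algebra_simps)
  have "bij_betw (res n) ?J {j\<in>{1..n}. P j \<in> sec k}"
    unfolding bij_betw_def
  proof
    show "inj_on (res n) ?J"
    proof (rule inj_onI)
      fix i j assume ij: "i \<in> ?J" "j \<in> ?J" "res n i = res n j"
      then obtain m where m: "i = j + m * int n"
        unfolding res_eq_iff[OF T.N_pos] mod_eq_dvd_iff dvd_def by (auto simp: algebra_simps)
      have "T i < T j + pi" "T j < T i + pi" using ij \<alpha>_gap[of k] by auto
      then have "2 * pi * of_int m < 2 * pi * 1" "2 * pi * (- 1) < 2 * pi * of_int m"
        unfolding m shift using pi_gt_zero by linarith+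
      then have "of_int m < (1::real)" "- 1 < (of_int m::real)" 
        using mult_less_cancel_left_pos[of "2 * pi" "of_int m" 1]
          mult_less_cancel_left_pos[of "2 * pi" "- 1" "of_int m"] by simp_all
      then have "m < 1" "- 1 < m" by linarith+
      then show "i = j" using m by simp
    qed
    show "res n ` ?J = {j\<in>{1..n}. P j \<in> sec k}"
    proof (intro equalityI subsetI)
      fix i assume "i \<in> res n ` ?J"
      then obtain j where j: "i = res n j" "\<alpha> (k - 1) < T j" "T j < \<alpha> k" by blast
      define m where "m = (j - 1) div int n"
      have i: "i \<in> {1..n}" using j res_in[OF T.N_pos] by simp
      have "int i = j + (- m) * int n" using int_res[OF T.N_pos, of j] j unfolding m_def by simp
      then have Ti: "T (int i) = T j + 2 * pi * of_int (- m)" using shift[of j "- m"] by simp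
      then have "cis (T (int i)) \<in> sec k"
        unfolding cis_mem_sec using j \<alpha>_period2[of k "- m"] \<alpha>_period2[of "k - 1" "- m"]
        by (intro exI[of _ "- m"]) (simp add: algebra_simps)
      with i show "i \<in> {j\<in>{1..n}. P j \<in> sec k}" by (simp add: P_eq)
    next
      fix i assume "i \<in> {j\<in>{1..n}. P j \<in> sec k}"
      then have i: "i \<in> {1..n}" "cis (T (int i)) \<in> sec k" by (auto simp: P_eq)
      then obtain m where m: "\<alpha> (k + m * (2 * int n) - 1) < T (int i)"
        "T (int i) < \<alpha> (k + m * (2 * int n))" unfolding cis_mem_sec by blast
      then have "int i + (- m) * int n \<in> ?J"
        unfolding mem_Collect_eq shift using \<alpha>_period2[of k m] \<alpha>_period2[of "k - 1" m]
        by (simp add: algebra_simps)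
      moreover have "res n (int i + (- m) * int n) = i"
        using res_add_mult[of n "int i" "- m"] res_of_nat[OF i(1)] by simp
      ultimately show "i \<in> res n ` ?J" by (intro rev_image_eqI) auto
    qed
  qed
  from bij_betw_same_card[OF this] show ?thesis by simp
qed

text \<open>Since the numbering is unique, the plane, its components and the choice of
  \<open>R\<close> disappear: the word depends only on how two real sequences interleave.\<close>

lemma occupancy_word_iff:
  "occupancy_word n P v \<longleftrightarrow>
    (\<forall>i\<in>{1..2 * n}. v i = card {j. \<alpha> (int i - 1) < T j \<and> T j < \<alpha> (int i)})"
proof -
  have "occupancy_word n P v \<longleftrightarrow> (\<forall>i\<in>{1..2 * n}. v i = card {j\<in>{1..n}. P j \<in> sec (int i)})"
  proof
    assume "occupancy_word n P v"
    then obtain R where R: "region_numbering n P R"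
      and v: "\<forall>i\<in>{1..2 * n}. v i = card {j\<in>{1..n}. P j \<in> R i}"
      unfolding occupancy_word_def by blast
    show "\<forall>i\<in>{1..2 * n}. v i = card {j\<in>{1..n}. P j \<in> sec (int i)}"
      using v region_numbering_unique[OF R] by simp
  next
    assume "\<forall>i\<in>{1..2 * n}. v i = card {j\<in>{1..n}. P j \<in> sec (int i)}"
    then show "occupancy_word n P v"
      unfolding occupancy_word_def using region_numbering_sec by blast
  qed
  then show ?thesis unfolding card_points_sec .
qed

end

section \<open>Interlacing words as levels\<close>

locale periodic_pred =
  fixes Q :: "int \<Rightarrow> bool" and N :: nat
  assumes N_pos: "N > 0"
    and period: "Q (k + int N) \<longleftrightarrow> Q k"
    and ex: "\<exists>k. Q k"
begin

lemma period_mult: "Q (k + m * int N) \<longleftrightarrow> Q k"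
proof (induction m rule: int_induct[where k = 0])
  case (step1 i)
  have "Q (k + (i + 1) * int N) = Q ((k + i * int N) + int N)" by (simp add: algebra_simps)
  then show ?case unfolding period using step1 by simp
next
  case (step2 i)
  have "Q (k + i * int N) = Q ((k + (i - 1) * int N) + int N)" by (simp add: algebra_simps)
  then show ?case unfolding period using step2 by simp
qed simp

lemma ex_window: "\<exists>i<N. Q (k + int i)"
proof -
  obtain l where "Q l" using ex by blast
  let ?i = "nat ((l - k) mod int N)"
  have "k + int ?i = l + (- ((l - k) div int N)) * int N"
    using N_pos minus_div_mult_eq_mod[of "l - k" "int N"] by simp
  then have "Q (k + int ?i)" using \<open>Q l\<close> period_mult by metis
  moreover have "?i < N" using N_pos by (simp add: nat_less_iff)
  ultimately show ?thesis by blast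
qed

text \<open>The search runs over natural distances, where \<open>LEAST\<close> is meaningful.
  Counting \<open>k\<close> itself here but not in \<open>next_gt\<close> makes the two occurrences
  enclose the boundary between \<open>k\<close> and \<open>k + 1\<close>.\<close>

definition last_le :: "int \<Rightarrow> int" where
  "last_le k = k - int (LEAST i. Q (k - int i))"

definition next_gt :: "int \<Rightarrow> int" where
  "next_gt k = k + 1 + int (LEAST i. Q (k + 1 + int i))"

lemma last_le: "Q (last_le k)" "last_le k \<le> k" "k - int N < last_le k"
  and last_le_max: "Q j \<Longrightarrow> j \<le> k \<Longrightarrow> j \<le> last_le k"
proof -
  obtain i where "i < N" "Q (k - int N + 1 + int i)" using ex_window[of "k - int N + 1"] by blast
  then have i: "Q (k - int (N - 1 - i))" "N - 1 - i < N" by (simp_all add: of_nat_diff algebra_simps)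
  show "Q (last_le k)" unfolding last_le_def by (rule LeastI[of "\<lambda>i. Q (k - int i)", OF i(1)])
  show "last_le k \<le> k" unfolding last_le_def by simp
  show "k - int N < last_le k"
    unfolding last_le_def using Least_le[of "\<lambda>i. Q (k - int i)", OF i(1)] i(2) by simp
  show "j \<le> last_le k" if "Q j" "j \<le> k"
    unfolding last_le_def using Least_le[of "\<lambda>i. Q (k - int i)" "nat (k - j)"] that by simp
qed

lemma next_gt: "Q (next_gt k)" "k < next_gt k" "next_gt k \<le> k + int N"
  and next_gt_min: "Q j \<Longrightarrow> k < j \<Longrightarrow> next_gt k \<le> j"
proof -
  obtain i where i: "i < N" "Q (k + 1 + int i)" using ex_window[of "k + 1"] by blast
  show "Q (next_gt k)" unfolding next_gt_def by (rule LeastI[of "\<lambda>i. Q (k + 1 + int i)", OF i(2)])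
  show "k < next_gt k" unfolding next_gt_def by simp
  show "next_gt k \<le> k + int N"
    unfolding next_gt_def using Least_le[of "\<lambda>i. Q (k + 1 + int i)", OF i(2)] i(1) by simp
  show "next_gt k \<le> j" if "Q j" "k < j"
    unfolding next_gt_def using Least_le[of "\<lambda>i. Q (k + 1 + int i)" "nat (j - k - 1)"] that by simp
qed

lemma last_le_eqI: "Q j \<Longrightarrow> j \<le> k \<Longrightarrow> (\<And>i. j < i \<Longrightarrow> i \<le> k \<Longrightarrow> \<not> Q i) \<Longrightarrow> last_le k = j"
  using last_le[of k] last_le_max[of j k] by (metis order_le_less)

lemma next_gt_eqI: "Q j \<Longrightarrow> k < j \<Longrightarrow> (\<And>i. k < i \<Longrightarrow> i < j \<Longrightarrow> \<not> Q i) \<Longrightarrow> next_gt k = j"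
  using next_gt[of k] next_gt_min[of j k] by (metis order_le_less)

lemma last_le_add: "last_le (k + int N) = last_le k + int N"
proof (rule last_le_eqI)
  fix i assume i: "last_le k + int N < i" "i \<le> k + int N"
  then show "\<not> Q i" using last_le_max[of "i - int N" k] period[of "i - int N"] by auto
qed (use last_le[of k] period in auto)

lemma next_gt_add: "next_gt (k + int N) = next_gt k + int N"
proof (rule next_gt_eqI)
  fix i assume i: "k + int N < i" "i < next_gt k + int N"
  then show "\<not> Q i" using next_gt_min[of "i - int N" k] period[of "i - int N"] by auto
qed (use next_gt[of k] period in auto)

end

lemma res_eqI: "x \<in> {1..N} \<Longrightarrow> k = int x + m * int N \<Longrightarrow> res N k = x"
  by (simp only: res_add_mult res_of_nat)

text \<open>Unrolls a cyclic interval to an ordinary one. The admissible extreme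
  \<open>b = a + n\<close> is the interval from an index around to itself.\<close>

lemma bij_betw_res_cyclic_between:
  assumes n: "n > 0" and ab: "a < b" "b \<le> a + int n"
  shows "bij_betw (res n) {a<..<b} (cyclic_between n (res n a) (res n b))"
  unfolding bij_betw_def
proof
  show "inj_on (res n) {a<..<b}"
  proof (rule inj_onI)
    fix k l assume kl: "k \<in> {a<..<b}" "l \<in> {a<..<b}" "res n k = res n l"
    then have "int n dvd k - l" using res_eq_iff[OF n] by (simp add: mod_eq_dvd_iff)
    moreover have "\<bar>k - l\<bar> < int n" using kl ab by auto
    ultimately show "k = l" using dvd_imp_le_int[of "k - l" "int n"] by force
  qed
  define i j p q where "i = res n a" and "j = res n b"
    and "p = (a - 1) div int n" and "q = (b - 1) div int n"
  have a: "a = int i + p * int n" and b: "b = int j + q * int n"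
    using int_res[OF n] unfolding i_def j_def p_def q_def by (simp_all add: algebra_simps)
  have ij: "i \<in> {1..n}" "j \<in> {1..n}" using res_in[OF n] unfolding i_def j_def by auto
  have "p \<le> q"
    unfolding p_def q_def using ab n by (intro zdiv_mono1) auto
  moreover have "(b - 1) div int n \<le> (a - 1 + int n) div int n" using ab n by (intro zdiv_mono1) auto
  then have "q \<le> p + 1" using n unfolding p_def q_def by simp
  ultimately consider "q = p" | "q = p + 1" by linarith
  then have "res n ` {a<..<b} = cyclic_between n i j"
  proof cases
    case 1
    then have "i < j" using ab a b by simp
    show ?thesis
    proof (intro equalityI subsetI)
      fix x assume "x \<in> res n ` {a<..<b}"
      then obtain k where k: "x = res n k" "a < k" "k < b" by auto
      have "res n k = nat (k - p * int n)"
        by (rule res_eqI[of _ _ _ p]) (use k a b 1 ij in auto)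
      then show "x \<in> cyclic_between n i j"
        unfolding cyclic_between_def using \<open>i < j\<close> k a b 1 by auto
    next
      fix x assume "x \<in> cyclic_between n i j"
      then have x: "i < x" "x < j" unfolding cyclic_between_def using \<open>i < j\<close> by auto
      have "res n (int x + p * int n) = x" by (rule res_eqI) (use x ij in auto)
      moreover have "int x + p * int n \<in> {a<..<b}" using x a b 1 by auto
      ultimately show "x \<in> res n ` {a<..<b}" by (intro rev_image_eqI) auto
    qed
  next
    case 2
    then have b': "b = int j + int n + p * int n" using b by (simp add: algebra_simps)
    then have "j \<le> i" using ab a by simp
    show ?thesis
    proof (intro equalityI subsetI)
      fix x assume "x \<in> res n ` {a<..<b}"
      then obtain k where k: "x = res n k" "a < k" "k < b" by auto
      show "x \<in> cyclic_between n i j"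
      proof (cases "k \<le> int n + p * int n")
        case True
        have "res n k = nat (k - p * int n)"
          by (rule res_eqI[of _ _ _ p]) (use k a b' True ij in auto)
        then show ?thesis
          unfolding cyclic_between_def using \<open>j \<le> i\<close> k a b' True by auto
      next
        case False
        have "res n k = nat (k - int n - p * int n)"
          by (rule res_eqI[of _ _ _ "p + 1"]) (use k a b' False ij in \<open>auto simp: algebra_simps\<close>)
        then show ?thesis
          unfolding cyclic_between_def using \<open>j \<le> i\<close> k a b' False by auto
      qed
    next
      fix x assume "x \<in> cyclic_between n i j"
      then consider "i < x" "x \<le> n" | "1 \<le> x" "x < j"
        unfolding cyclic_between_def using \<open>j \<le> i\<close> by (auto split: if_splits)
      then show "x \<in> res n ` {a<..<b}"
      proof cases
        case 1
        have "res n (int x + p * int n) = x" by (rule res_eqI) (use 1 ij in auto)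
        moreover have "int x + p * int n \<in> {a<..<b}" using 1 a b' ij by auto
        ultimately show ?thesis by (intro rev_image_eqI) auto
      next
        case 2
        have "res n (int x + (p + 1) * int n) = x" by (rule res_eqI) (use 2 ij in auto)
        moreover have "int x + (p + 1) * int n \<in> {a<..<b}" using 2 a b' ij by (auto simp: algebra_simps)
        ultimately show ?thesis by (intro rev_image_eqI) auto
      qed
    qed
  qed
  then show "res n ` {a<..<b} = cyclic_between n (res n a) (res n b)"
    unfolding i_def j_def .
qed

lemma bij_betw_ex1_iff:
  assumes "bij_betw f A B"
  shows "(\<exists>!y. y \<in> B \<and> R y) \<longleftrightarrow> (\<exists>!x. x \<in> A \<and> R (f x))"
proof -
  have f: "f ` A = B" "inj_on f A" using assms unfolding bij_betw_def by auto
  show ?thesis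
  proof
    assume "\<exists>!y. y \<in> B \<and> R y"
    then obtain y where y: "y \<in> B" "R y" "\<And>z. z \<in> B \<Longrightarrow> R z \<Longrightarrow> z = y" by blast
    then obtain x where x: "x \<in> A" "f x = y" using f(1) by blast
    show "\<exists>!x. x \<in> A \<and> R (f x)"
    proof (rule ex1I[of _ x])
      fix x' assume x': "x' \<in> A \<and> R (f x')"
      then have "f x' = y" using y(3)[of "f x'"] f(1) by blast
      then show "x' = x" using inj_onD[OF f(2), of x' x] x x' by simp
    qed (use x y in blast)
  next
    assume "\<exists>!x. x \<in> A \<and> R (f x)"
    then obtain x where x: "x \<in> A" "R (f x)" "\<And>z. z \<in> A \<Longrightarrow> R (f z) \<Longrightarrow> z = x" by blast
    show "\<exists>!y. y \<in> B \<and> R y"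
      by (rule ex1I[of _ "f x"]) (use x f(1) in blast)+
  qed
qed

lemma interlacing_iff_int:
  assumes n: "n > 0"
  shows "interlacing n s \<longleftrightarrow>
    (\<exists>k. s (res n k) = 0) \<and> (\<exists>k. s (res n k) = 2) \<and>
    (\<forall>a b. a < b \<and> b \<le> a + int n \<and> s (res n a) = 0 \<and> s (res n b) = 0 \<and>
      (\<forall>k\<in>{a<..<b}. s (res n k) \<noteq> 0) \<longrightarrow> (\<exists>!k. k \<in> {a<..<b} \<and> s (res n k) = 2))"
    (is "_ \<longleftrightarrow> _ \<and> _ \<and> (\<forall>a b. ?I a b)")
proof -
  have ex: "(\<exists>k. s (res n k) = x) \<longleftrightarrow> (\<exists>i\<in>{1..n}. s i = x)" for x
    using res_in[OF n] res_of_nat[of _ n] by metis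
  have all: "(\<forall>k\<in>cyclic_between n (res n a) (res n b). s k \<noteq> 0) \<longleftrightarrow> (\<forall>k\<in>{a<..<b}. s (res n k) \<noteq> 0)"
    "(\<exists>!k. k \<in> cyclic_between n (res n a) (res n b) \<and> s k = 2) \<longleftrightarrow>
      (\<exists>!k. k \<in> {a<..<b} \<and> s (res n k) = 2)"
    if "a < b" "b \<le> a + int n" for a b
    using bij_betw_ex1_iff[OF bij_betw_res_cyclic_between[OF n that], of "\<lambda>k. s k = 2"]
    by (simp_all flip: bij_betw_imp_surj_on[OF bij_betw_res_cyclic_between[OF n that]])
  have "(\<forall>a b. ?I a b) \<longleftrightarrow>
    (\<forall>i\<in>{1..n}. \<forall>j\<in>{1..n}. s i = 0 \<and> s j = 0 \<and> (\<forall>k\<in>cyclic_between n i j. s k \<noteq> 0) \<longrightarrow>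
      (\<exists>!k. k \<in> cyclic_between n i j \<and> s k = 2))" (is "_ \<longleftrightarrow> ?R")
  proof
    assume H: "\<forall>a b. ?I a b"
    show ?R
    proof (intro ballI)
      fix i j assume ij: "i \<in> {1..n}" "j \<in> {1..n}"
      \<comment> \<open>The first integer after \<open>i\<close> in the class of \<open>j\<close>; a
        full turn later if \<open>i = j\<close>.\<close>
      define b where "b = (if i < j then int j else int j + int n)"
      have b: "int i < b" "b \<le> int i + int n" using ij unfolding b_def by auto
      have r: "res n (int i) = i" "res n b = j" using ij unfolding b_def by (auto simp: res_of_nat)
      show "s i = 0 \<and> s j = 0 \<and> (\<forall>k\<in>cyclic_between n i j. s k \<noteq> 0) \<longrightarrow>
          (\<exists>!k. k \<in> cyclic_between n i j \<and> s k = 2)"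
      proof (intro impI, elim conjE)
        assume "s i = 0" "s j = 0" "\<forall>k\<in>cyclic_between n i j. s k \<noteq> 0"
        then have "\<forall>k\<in>{int i<..<b}. s (res n k) \<noteq> 0" using all(1)[OF b] unfolding r by simp
        then have "\<exists>!k. k \<in> {int i<..<b} \<and> s (res n k) = 2"
          using H b \<open>s i = 0\<close> \<open>s j = 0\<close> r by simp
        then show "\<exists>!k. k \<in> cyclic_between n i j \<and> s k = 2"
          using all(2)[OF b] unfolding r by (rule iffD2[rotated])
      qed
    qed
  next
    assume R: ?R
    show "\<forall>a b. ?I a b"
    proof (intro allI impI, elim conjE)
      fix a b assume ab: "a < b" "b \<le> a + int n" and s: "s (res n a) = 0" "s (res n b) = 0"
        and nz: "\<forall>k\<in>{a<..<b}. s (res n k) \<noteq> 0"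
      have "\<forall>k\<in>cyclic_between n (res n a) (res n b). s k \<noteq> 0" using nz all(1)[OF ab] by simp
      then have "\<exists>!k. k \<in> cyclic_between n (res n a) (res n b) \<and> s k = 2"
        using R s res_in[OF n] by simp
      then show "\<exists>!k. k \<in> {a<..<b} \<and> s (res n k) = 2"
        using all(2)[OF ab] by (rule iffD1[rotated])
    qed
  qed
  moreover have "(\<exists>i\<in>{1..n}. \<exists>j\<in>{1..n}. s i = 0 \<and> s j = 2) \<longleftrightarrow>
      (\<exists>i\<in>{1..n}. s i = 0) \<and> (\<exists>j\<in>{1..n}. s j = 2)" by blast
  ultimately show ?thesis unfolding interlacing_def ex by (simp only: conj_assoc)
qed

text \<open>A discrete intermediate value argument, stated for two arbitrary values so that it finds
  rises as well as drops.\<close>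

lemma ex_step_between:
  fixes g :: "int \<Rightarrow> int"
  assumes "\<And>k. g k \<in> {x, y}" "g a = x" "g b = y" "a < b" "x \<noteq> y"
  shows "\<exists>l. a < l \<and> l \<le> b \<and> g (l - 1) = x \<and> g l = y"
  using assms(4,3)
proof (induction b rule: int_gr_induct)
  case base
  then show ?case using assms by (intro exI[of _ "a + 1"]) auto
next
  case (step i)
  show ?case
  proof (cases "g i = y")
    case True
    with step obtain l where "a < l" "l \<le> i" "g (l - 1) = x" "g l = y" by blast
    then show ?thesis by (intro exI[of _ l]) auto
  next
    case False
    then show ?thesis using assms(1)[of i] step by (intro exI[of _ "i + 1"]) auto
  qed
qed

text \<open>
  The level \<open>g\<close> rises by one at each letter 2 and drops by one at each letter 0, so that it can
  stay in \<open>{0, 1}\<close> exactly when these letters alternate cyclically.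
\<close>

lemma interlacing_iff_level:
  assumes n: "n > 0" and le: "\<And>k. s (res n k) \<le> (2::nat)"
  shows "interlacing n s \<longleftrightarrow>
    (\<exists>g::int \<Rightarrow> int. (\<forall>k. g (k + int n) = g k) \<and> (\<forall>k. g k \<in> {0, 1}) \<and>
      (\<forall>k. g k = g (k - 1) + int (s (res n k)) - 1) \<and> (\<exists>k. s (res n k) \<noteq> 1))"
proof
  let ?S = "\<lambda>k. s (res n k)"
  assume "interlacing n s"
  then have ex0: "\<exists>k. ?S k = 0" and ex2: "\<exists>k. ?S k = 2"
    and uniq: "\<And>a b. a < b \<Longrightarrow> b \<le> a + int n \<Longrightarrow> ?S a = 0 \<Longrightarrow> ?S b = 0 \<Longrightarrow>
      (\<And>k. a < k \<Longrightarrow> k < b \<Longrightarrow> ?S k \<noteq> 0) \<Longrightarrow> \<exists>!k. k \<in> {a<..<b} \<and> ?S k = 2"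
    unfolding interlacing_iff_int[OF n] by auto
  interpret Z: periodic_pred "\<lambda>k. ?S k = 0" n
    using n ex0 by unfold_locales auto
  interpret D: periodic_pred "\<lambda>k. ?S k \<noteq> 1" n
  proof
    show "\<exists>k. ?S k \<noteq> 1" using ex0 by (metis zero_neq_one)
  qed (use n in auto)
  \<comment> \<open>Letters 1 leave the level unchanged, so the last other letter must determine
    it.\<close>
  define g :: "int \<Rightarrow> int" where "g k = (if ?S (D.last_le k) = 2 then 1 else 0)" for k
  have D02: "?S (D.last_le k) = 0 \<or> ?S (D.last_le k) = 2" for k
    using D.last_le(1)[of k] le[of "D.last_le k"] by linarith
  have step: "g k = g (k - 1) + int (?S k) - 1" for k
  proof (cases "?S k = 1")
    case True
    have "D.last_le k = D.last_le (k - 1)"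
    proof (rule D.last_le_eqI)
      show "\<not> ?S i \<noteq> 1" if "D.last_le (k - 1) < i" "i \<le> k" for i
        using that True D.last_le_max[of i "k - 1"] by (cases "i = k") auto
    qed (use D.last_le[of "k - 1"] in auto)
    then show ?thesis unfolding g_def using True by simp
  next
    case False
    define j where "j = D.last_le (k - 1)"
    have j: "j < k" "k \<le> j + int n" "?S j = 0 \<or> ?S j = 2"
      using D.last_le[of "k - 1"] D02 unfolding j_def by auto
    have ones: "?S i = 1" if "j < i" "i < k" for i
      using that D.last_le_max[of i "k - 1"] unfolding j_def by force
    have "D.last_le k = k" using False by (intro D.last_le_eqI) auto
    then have gk: "g k = (if ?S k = 2 then 1 else 0)" unfolding g_def by simp
    have gk1: "g (k - 1) = (if ?S j = 2 then 1 else 0)" unfolding g_def j_def ..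
    have "?S k = 0 \<or> ?S k = 2" using False le[of k] by linarith
    then show ?thesis
    proof
      assume k0: "?S k = 0"
      have "?S j \<noteq> 0"
      proof
        assume "?S j = 0"
        with uniq[OF j(1,2) _ k0] ones obtain l where "l \<in> {j<..<k}" "?S l = 2" by force
        then show False using ones[of l] by simp
      qed
      then show ?thesis using gk gk1 j(3) k0 by simp
    next
      assume k2: "?S k = 2"
      have "?S j \<noteq> 2"
      proof
        assume j2: "?S j = 2"
        \<comment> \<open>Two letters 2 with only letters 1 between them are enclosed by
          neighbouring letters 0, whose interval would then contain two letters 2.\<close>
        define a b where "a = Z.last_le j" and "b = Z.next_gt k"
        have a: "?S a = 0" "a \<le> j" "a \<noteq> j" and b: "?S b = 0" "k < b"
          using Z.last_le[of j] Z.next_gt[of k] j2 unfolding a_def b_def by auto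
        have no0: "?S i \<noteq> 0" if "a < i" "i < b" for i
        proof
          assume "?S i = 0"
          then show False
            using that Z.last_le_max[of i j] Z.next_gt_min[of i k] ones[of i] j2 k2
            unfolding a_def b_def by (cases "i < j"; cases "i = j"; cases "i = k"; cases "i < k") auto
        qed
        have "?S (a + int n) = 0" using a by simp
        then have "b \<le> a + int n" using no0[of "a + int n"] n by (meson less_add_same_cancel1 not_le of_nat_0_less_iff)
        then have "\<exists>!l. l \<in> {a<..<b} \<and> ?S l = 2"
          using uniq[of a b] a b j no0 by auto
        moreover have "j \<in> {a<..<b}" "k \<in> {a<..<b}" using a b j by auto
        ultimately show False using j2 k2 j(1) by blast
      qed
      then show ?thesis using gk gk1 j(3) k2 by simp
    qed
  qed
  have "g (k + int n) = g k" for k unfolding g_def D.last_le_add by simp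
  moreover have "g k \<in> {0, 1}" for k unfolding g_def by simp
  moreover have "\<exists>k. ?S k \<noteq> 1" using D.ex .
  ultimately show "\<exists>g::int \<Rightarrow> int. (\<forall>k. g (k + int n) = g k) \<and> (\<forall>k. g k \<in> {0, 1}) \<and>
      (\<forall>k. g k = g (k - 1) + int (?S k) - 1) \<and> (\<exists>k. ?S k \<noteq> 1)"
    using step by blast
next
  let ?S = "\<lambda>k. s (res n k)"
  assume "\<exists>g::int \<Rightarrow> int. (\<forall>k. g (k + int n) = g k) \<and> (\<forall>k. g k \<in> {0, 1}) \<and>
      (\<forall>k. g k = g (k - 1) + int (?S k) - 1) \<and> (\<exists>k. ?S k \<noteq> 1)"
  then obtain g :: "int \<Rightarrow> int" and k0 where per: "\<And>k. g (k + int n) = g k"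
    and g01: "\<And>k. g k \<in> {0, 1}" and step: "\<And>k. g k = g (k - 1) + int (?S k) - 1"
    and k0: "?S k0 \<noteq> 1" by blast
  have g10: "g k \<in> {1, 0}" for k using g01[of k] by auto
  have S0: "?S k = 0 \<longleftrightarrow> g (k - 1) = 1 \<and> g k = 0" for k
    using step[of k] g01[of k] g01[of "k - 1"] by auto
  have S2: "?S k = 2 \<longleftrightarrow> g (k - 1) = 0 \<and> g k = 1" for k
    using step[of k] g01[of k] g01[of "k - 1"] by auto
  have "?S k0 = 0 \<or> ?S k0 = 2" using k0 le[of k0] by linarith
  then have "(\<exists>k. ?S k = 0) \<and> (\<exists>k. ?S k = 2)"
  proof
    assume z: "?S k0 = 0"
    \<comment> \<open>One turn after \<open>k0 - 1\<close> the level has its value from before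
      \<open>k0\<close> again, so the opposite step happens in between; for n = 1 there would be no
      room, but then the level is constant.\<close>
    have "k0 < k0 - 1 + int n"
    proof (rule ccontr)
      assume "\<not> k0 < k0 - 1 + int n"
      then have "int n = 1" using n by simp
      then have "g k0 = g (k0 - 1)" using per[of "k0 - 1"] by simp
      then show False using z S0[of k0] by simp
    qed
    then show ?thesis
      using ex_step_between[of g 0 1 k0 "k0 - 1 + int n", OF g01] z S0[of k0] S2 per[of "k0 - 1"] by auto
  next
    assume z: "?S k0 = 2"
    have "k0 < k0 - 1 + int n"
    proof (rule ccontr)
      assume "\<not> k0 < k0 - 1 + int n"
      then have "int n = 1" using n by simp
      then have "g k0 = g (k0 - 1)" using per[of "k0 - 1"] by simp
      then show False using z S2[of k0] by simp
    qed
    then show ?thesis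
      using ex_step_between[of g 1 0 k0 "k0 - 1 + int n", OF g10] z S2[of k0] S0 per[of "k0 - 1"] by auto
  qed
  moreover have "\<exists>!k. k \<in> {a<..<b} \<and> ?S k = 2"
    if ab: "a < b" "?S a = 0" "?S b = 0" "\<forall>k\<in>{a<..<b}. ?S k \<noteq> 0" for a b
  proof -
    have "g a = 0" "g (b - 1) = 1" using ab S0 by auto
    moreover from this have "a < b - 1" using ab by (cases "a = b - 1") auto
    ultimately obtain l where l: "a < l" "l \<le> b - 1" "?S l = 2"
      using ex_step_between[of g 0 1 a "b - 1", OF g01] S2 by auto
    have no: False if kl: "a < k" "k < l'" "l' < b" "?S k = 2" "?S l' = 2" for k l'
    proof -
      have "g k = 1" "g (l' - 1) = 0" using kl S2 by auto
      moreover from this have "k < l' - 1" using kl by (cases "k = l' - 1") auto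
      ultimately obtain m where "k < m" "m \<le> l' - 1" "?S m = 0"
        using ex_step_between[of g 1 0 k "l' - 1", OF g10] S0 by auto
      then show False using ab kl by auto
    qed
    show ?thesis
    proof (rule ex1I[of _ l])
      show "l \<in> {a<..<b} \<and> ?S l = 2" using l by auto
      show "k = l" if "k \<in> {a<..<b} \<and> ?S k = 2" for k
        using that l no[of k l] no[of l k] by (cases k l rule: linorder_cases) auto
    qed
  qed
  ultimately show "interlacing n s" unfolding interlacing_iff_int[OF n] by blast
qed

section \<open>Realizable words are interlacing\<close>

lemma sum_diff_int:
  fixes h :: "int \<Rightarrow> real"
  shows "(\<Sum>i=1..m. h (int i) - h (int i - 1)) = h (int m) - h 0"
  by (induction m) auto

lemma ex_strict_mono_enumeration:
  fixes B :: "'a::linorder set"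
  assumes "finite B" "card B = n"
  shows "\<exists>f. strict_mono_on {1..n} f \<and> f ` {1..n} = B"
proof (intro exI conjI)
  let ?xs = "sorted_list_of_set B"
  let ?f = "\<lambda>i. ?xs ! (i - 1)"
  have len: "length ?xs = n" using assms by simp
  show "strict_mono_on {1..n} ?f"
    by (rule strict_mono_onI)
       (use len strict_sorted_list_of_set[of B] in \<open>auto simp: sorted_wrt_iff_nth_less\<close>)
  have "?f ` {1..n} = (\<lambda>i. ?xs ! i) ` {..<n}"
  proof -
    have "{..<n} = (\<lambda>i. i - 1) ` {1..n}"
    proof (intro equalityI subsetI)
      fix i assume "i \<in> {..<n}"
      then show "i \<in> (\<lambda>i. i - 1) ` {1..n}" by (intro image_eqI[of _ _ "i + 1"]) auto
    qed auto
    then show ?thesis by (simp add: image_image)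
  qed
  also have "\<dots> = set ?xs" using len by (auto simp: set_conv_nth)
  finally show "?f ` {1..n} = B" using assms by simp
qed

text \<open>The meeting point of both directions: it is extracted from given points in generic
  position, and it is what the construction has to deliver.\<close>

locale generic_config = circle_config +
  assumes T_ne_\<alpha>: "T j \<noteq> \<alpha> k"
begin

lemma generic_position: "generic_position n P"
  unfolding generic_position_def
proof (intro conjI ballI)
  show "inj_on (bisector_line n P) {1..n}" by (rule inj_on_bisector_line)
  fix i assume i: "i \<in> {1..n}"
  show "1 \<notin> bisector_line n P i"
  proof
    assume "1 \<in> bisector_line n P i"
    then have "\<exists>i\<in>{1..n}. cis 0 \<in> bisector_line n P i" using i by auto
    then obtain k where k: "\<alpha> k = 0" unfolding cis_mem_lines_iff by force
    then have "\<alpha> 0 < \<alpha> k" "\<alpha> k < \<alpha> 1" using \<alpha>_0 \<alpha>_1 by simp_all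
    then show False by simp
  qed
  fix j assume j: "j \<in> {1..n}"
  show "P j \<notin> bisector_line n P i"
  proof
    assume "P j \<in> bisector_line n P i"
    then have "\<exists>i\<in>{1..n}. cis (T (int j)) \<in> bisector_line n P i" using i j by (auto simp: P_eq)
    then show False unfolding cis_mem_lines_iff using T_ne_\<alpha> by blast
  qed
qed

text \<open>
  Reading the circle counterclockwise, \<open>P\<^sub>j\<close> and the ray bisecting the arc from \<open>P\<^sub>j\<close> to the next
  point alternate; \<open>f x\<close> is 1 or 0 according to which of the two was met last.
\<close>

definition f :: "real \<Rightarrow> int" where
  "f x = T.idx x - M.idx x"

text \<open>Each \<open>\<mu> j\<close> lies strictly between \<open>T j\<close> and
  \<open>T (j + 1)\<close>, so the two counts never drift apart.\<close>

lemma f_01: "f x \<in> {0, 1}"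
proof -
  have "\<mu> (T.idx x - 1) \<le> x" using \<mu>(2)[of "T.idx x - 1"] T.idx[of x] by simp
  then have "T.idx x - 1 \<le> M.idx x" by (simp add: M.le_idx_iff)
  moreover have "x < \<mu> (T.idx x + 1)" using \<mu>(1)[of "T.idx x + 1"] T.idx[of x] by simp
  then have "M.idx x < T.idx x + 1" by (simp add: M.less_idx_iff)
  ultimately show ?thesis unfolding f_def by auto
qed

lemma f_add: "f (x + 2 * pi) = f x"
  unfolding f_def T.idx_add M.idx_add by simp

lemma f_\<mu>: "f (\<mu> j) = 0"
proof -
  have "T.idx (\<mu> j) = j" using \<mu>[of j] by (intro T.idx_eqI) auto
  then show ?thesis unfolding f_def by simp
qed

text \<open>All bisecting rays occur among the \<open>\<alpha>\<close>, so none lies strictly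
  between two consecutive ones.\<close>

lemma M_idx_step: "M.idx (\<alpha> k) = M.idx (\<alpha> (k - 1)) + (if \<alpha> k \<in> range \<mu> then 1 else 0)"
proof -
  have *: "\<mu> i \<le> \<alpha> (k - 1)" if "\<mu> i < \<alpha> k" for i
  proof -
    obtain l where "\<mu> i = \<alpha> l" using mid_ray by blast
    then show ?thesis using that by simp
  qed
  show ?thesis
  proof (cases "\<alpha> k \<in> range \<mu>")
    case True
    then obtain j where j: "\<alpha> k = \<mu> j" by blast
    have "\<mu> (j - 1) \<le> \<alpha> (k - 1)" using * j by simp
    moreover have "\<alpha> (k - 1) < \<mu> j" unfolding j[symmetric] by simp
    ultimately have "M.idx (\<alpha> (k - 1)) = j - 1" by (intro M.idx_eqI) auto
    then show ?thesis using True j by simp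
  next
    case False
    let ?i = "M.idx (\<alpha> k)"
    have "\<mu> ?i < \<alpha> k" using M.idx(1)[of "\<alpha> k"] False by (metis order_le_less rangeI)
    then have "\<mu> ?i \<le> \<alpha> (k - 1)" using * by simp
    moreover have "\<alpha> (k - 1) < \<mu> (?i + 1)"
      using M.idx(2)[of "\<alpha> k"] A.less_iff[of "k - 1" k] by linarith
    ultimately have "M.idx (\<alpha> (k - 1)) = ?i" by (intro M.idx_eqI) auto
    then show ?thesis using False by simp
  qed
qed

text \<open>Of the two rays of a line exactly one bisects an arc. The parity of the number of half
  turns decides which; if both did, two indices would give the same line, hence agree modulo n, and
  pi would be a multiple of 2*pi.\<close>

lemma ray_or_antiray: "\<alpha> k \<in> range \<mu> \<longleftrightarrow> \<alpha> (k + int n) \<notin> range \<mu>"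
proof -
  obtain j and t :: int where jt: "\<alpha> k = \<mu> j + of_int t * pi" using ray_mid by blast
  have "\<alpha> k \<in> range \<mu> \<or> \<alpha> (k + int n) \<in> range \<mu>"
  proof (cases "even t")
    case True
    then obtain r where "t = 2 * r" by blast
    then have "\<alpha> k = \<mu> (j + r * int n)" using jt \<mu>_add_mult[of j r] by simp
    then show ?thesis by blast
  next
    case False
    then obtain r where "t = 2 * r + 1" by (rule oddE)
    then have "\<alpha> (k + int n) = \<mu> (j + (r + 1) * int n)"
      unfolding A.period using jt \<mu>_add_mult[of j "r + 1"] by (simp add: algebra_simps)
    then show ?thesis by blast
  qed
  moreover have "\<not> (\<alpha> k \<in> range \<mu> \<and> \<alpha> (k + int n) \<in> range \<mu>)"
  proof
    assume "\<alpha> k \<in> range \<mu> \<and> \<alpha> (k + int n) \<in> range \<mu>"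
    then obtain i j where i: "\<alpha> k = \<mu> i" and j: "\<alpha> k + pi = \<mu> j" unfolding A.period by blast
    have "ray_line (\<mu> i) = ray_line (\<mu> j)"
      unfolding ray_line_eq_iff sin_zero_iff_int2
      by (intro exI[of _ "- 1"]) (use i j in simp)
    then have "bisector_line n P (res n i) = bisector_line n P (res n j)"
      using res_in[OF T.N_pos] by (simp add: bisector_line ray_line_\<mu>_res)
    then have "res n i = res n j"
      using inj_onD[OF inj_on_bisector_line] res_in[OF T.N_pos] by blast
    then have "int n dvd j - i"
      unfolding res_eq_iff[OF T.N_pos] by (simp add: mod_eq_dvd_iff dvd_diff_commute)
    then obtain m where "j - i = int n * m" by blast
    then have "j = i + m * int n" by (simp add: algebra_simps)
    then have "pi * 1 = pi * (2 * of_int m)" using \<mu>_add_mult[of i m] i j by simp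
    then have "of_int 1 = (of_int (2 * m) :: real)" using pi_neq_zero mult_left_cancel[of pi 1 "2 * of_int m"] by simp
    then have "1 = 2 * m" unfolding of_int_eq_iff .
    then show False by presburger
  qed
  ultimately show ?thesis by blast
qed

section \<open>The level along the half turn\<close>

definition cnt :: "int \<Rightarrow> nat" where
  "cnt k = card {j. \<alpha> (k - 1) < T j \<and> T j < \<alpha> k}"

lemma cnt: "int (cnt k) = T.idx (\<alpha> k) - T.idx (\<alpha> (k - 1))"
  unfolding cnt_def
proof (rule T.card_Ioo)
  show "\<alpha> k \<notin> range T" using T_ne_\<alpha> by (metis rangeE)
qed simp

lemma idx_\<alpha>_shift: "T.idx (\<alpha> (k + 2 * int n)) = T.idx (\<alpha> k) + int n"
  using \<alpha>_period2[of k 1] T.idx_add[of "\<alpha> k"] by simp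

definition g :: "int \<Rightarrow> int" where
  "g k = f (\<alpha> k) + f (\<alpha> (k + int n))"

lemma g_period: "g (k + int n) = g k"
proof -
  have "f (\<alpha> (k + int n + int n)) = f (\<alpha> k)"
    using \<alpha>_period2[of k 1] f_add[of "\<alpha> k"] by (simp add: algebra_simps)
  then show ?thesis unfolding g_def by simp
qed

text \<open>One of the two rays of the line is a bisecting ray, and there \<open>f\<close>
  vanishes.\<close>

lemma g_01: "g k \<in> {0, 1}"
proof -
  have "f (\<alpha> k) = 0 \<or> f (\<alpha> (k + int n)) = 0"
    using ray_or_antiray[of k] f_\<mu> by (metis rangeE)
  then show ?thesis unfolding g_def using f_01[of "\<alpha> k"] f_01[of "\<alpha> (k + int n)"] by auto
qed

lemma g_step: "g k = g (k - 1) + int (cnt k + cnt (k + int n)) - 1"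
proof -
  have e: "k + int n - 1 = k - 1 + int n" by simp
  show ?thesis
    using M_idx_step[of k] M_idx_step[of "k + int n"] ray_or_antiray[of k] cnt[of k] cnt[of "k + int n"]
    unfolding g_def f_def e by (auto split: if_splits)
qed

text \<open>\<open>K\<close> locates the bisecting rays among the \<open>\<alpha>\<close>. Different
  bisectors are different lines, so the indices \<open>K j + c\<close> run through all residues
  modulo n and the gaps fill exactly one half turn. The values c = 0 and c = 1 give the gaps before
  and after the rays.\<close>

lemma sum_gaps:
  assumes "\<And>j. \<alpha> (K j) = \<mu> j"
  shows "(\<Sum>j=1..n. \<alpha> (K (int j) + c) - \<alpha> (K (int j) + c - 1)) = pi"
proof -
  define D where "D k = \<alpha> k - \<alpha> (k - 1)" for k
  have D_res: "D (int (res n k)) = D k" for k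
  proof -
    have "int (res n k) = k + (- ((k - 1) div int n)) * int n" using int_res[OF T.N_pos, of k] by simp
    moreover have "D (k + m * int n) = D k" for m
      using A.period_mult[of k m] A.period_mult[of "k - 1" m] unfolding D_def by (simp add: algebra_simps)
    ultimately show ?thesis by metis
  qed
  let ?r = "\<lambda>j::nat. res n (K (int j) + c)"
  have inj: "inj_on ?r {1..n}"
  proof (rule inj_onI)
    fix i j assume ij: "i \<in> {1..n}" "j \<in> {1..n}" "?r i = ?r j"
    then have "K (int i) mod int n = K (int j) mod int n"
      unfolding res_eq_iff[OF T.N_pos] by (simp add: mod_eq_dvd_iff)
    then have "ray_line (\<mu> (int i)) = ray_line (\<mu> (int j))"
      using ray_line_\<alpha>_eq_iff assms by metis
    then show "i = j"
      using inj_onD[OF inj_on_bisector_line, of i j] ij by (simp add: bisector_line)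
  qed
  have "?r ` {1..n} = {1..n}"
    using endo_inj_surj[OF _ _ inj] res_in[OF T.N_pos] by blast
  have "(\<Sum>j=1..n. \<alpha> (K (int j) + c) - \<alpha> (K (int j) + c - 1)) = (\<Sum>j=1..n. D (int (?r j)))"
    by (simp only: D_res) (simp only: D_def)
  also have "\<dots> = (\<Sum>i\<in>?r ` {1..n}. D (int i))" by (simp only: sum.reindex[OF inj] o_def)
  also have "\<dots> = (\<Sum>i=1..n. D (int i))" using \<open>?r ` {1..n} = {1..n}\<close> by simp
  also have "\<dots> = \<alpha> (int n) - \<alpha> 0" unfolding D_def by (rule sum_diff_int)
  also have "\<dots> = pi" using A.period[of 0] by simp
  finally show ?thesis .
qed

text \<open>
  If every region pair carried exactly one point, then \<open>g\<close> would be constant, and the arcs from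
  \<open>P\<^sub>j\<close> to the bisecting ray (if \<open>g = 0\<close>) or from that ray to the next point (if \<open>g = 1\<close>), of total
  length \<open>\<pi>\<close>, would fit with room to spare into distinct gaps between the lines, of total
  length \<open>\<pi>\<close> as well.
\<close>

lemma ex_cnt_ne_1: "\<exists>k. cnt k + cnt (k + int n) \<noteq> 1"
proof (rule ccontr)
  assume "\<not> ?thesis"
  then have "g k = g (k - 1)" for k using g_step[of k] by simp
  then have const: "g k = g 0" for k
  proof (induction k rule: int_induct[where k = 0])
    case (step1 i) then show ?case by (metis add_diff_cancel_right')
  next
    case (step2 i) then show ?case by metis
  qed simp
  obtain K where K: "\<alpha> (K j) = \<mu> j" for j using mid_ray by metis
  have half: "(\<Sum>j=1..n. \<mu> (int j) - T (int j)) = pi" "(\<Sum>j=1..n. T (int j + 1) - \<mu> (int j)) = pi"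
  proof -
    have "(\<Sum>j=1..n. T (int j + 1) - T (int j)) = 2 * pi"
      using sum_diff_int[of "\<lambda>k. T (k + 1)" n] T.period[of 1] by (simp add: add_ac)
    moreover have e: "\<mu> j - T j = (T (j + 1) - T j) / 2" "T (j + 1) - \<mu> j = (T (j + 1) - T j) / 2" for j
      unfolding \<mu>_def by (simp_all add: field_simps)
    ultimately show "(\<Sum>j=1..n. \<mu> (int j) - T (int j)) = pi" "(\<Sum>j=1..n. T (int j + 1) - \<mu> (int j)) = pi"
      by (simp_all only: e flip: sum_divide_distrib)
  qed
  have n: "{1..n} \<noteq> {}" using n_gt_1 by auto
  show False
  proof (cases "g 0 = 0")
    case True
    have f0: "f (\<alpha> k) = 0" for k
      using const[of k] True f_01[of "\<alpha> k"] f_01[of "\<alpha> (k + int n)"] unfolding g_def by auto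
    have "\<mu> j - T j < \<alpha> (K j + 0) - \<alpha> (K j + 0 - 1)" for j
    proof -
      have "\<alpha> (K j - 1) < T j"
      proof (rule ccontr)
        \<comment> \<open>Then the point j would have been met before the preceding line and its
          bisecting ray not yet: \<open>f\<close> would be 1 there.\<close>
        assume H: "\<not> \<alpha> (K j - 1) < T j"
        have "\<alpha> (K j - 1) < \<mu> j" unfolding K[symmetric] by simp
        then have "T.idx (\<alpha> (K j - 1)) = j" using H \<mu>[of j] by (intro T.idx_eqI) auto
        moreover have "\<alpha> (K j) \<in> range \<mu>" using K by simp
        then have "M.idx (\<alpha> (K j - 1)) = j - 1" using M_idx_step[of "K j"] K[of j] by simp
        ultimately show False using f0[of "K j - 1"] unfolding f_def by simp
      qed
      then show ?thesis using K[of j] by simp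
    qed
    then have "(\<Sum>j=1..n. \<mu> (int j) - T (int j)) < (\<Sum>j=1..n. \<alpha> (K (int j) + 0) - \<alpha> (K (int j) + 0 - 1))"
      using n by (intro sum_strict_mono) auto
    then show False unfolding half sum_gaps[OF K] by simp
  next
    case False
    then have g1: "f (\<alpha> k) + f (\<alpha> (k + int n)) = 1" for k
      using const[of k] g_01[of k] unfolding g_def by auto
    have "T (j + 1) - \<mu> j < \<alpha> (K j + 1) - \<alpha> (K j + 1 - 1)" for j
    proof -
      have "T (j + 1) < \<alpha> (K j + 1)"
      proof (rule ccontr)
        \<comment> \<open>Then the line after the bisecting ray precedes the next point, so
          \<open>f\<close> is 0 there. That angle is not a bisecting ray, so the opposite one is,
          and the level would be 0 instead of 1.\<close>
        assume "\<not> T (j + 1) < \<alpha> (K j + 1)"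
        then have H: "\<alpha> (K j + 1) < T (j + 1)" using T_ne_\<alpha>[of "j + 1" "K j + 1"] by simp
        have m: "\<mu> j < \<alpha> (K j + 1)" unfolding K[symmetric] by simp
        have i: "M.idx (\<alpha> (K j + 1)) = j" using m H \<mu>(1)[of "j + 1"] by (intro M.idx_eqI) auto
        moreover have "T.idx (\<alpha> (K j + 1)) = j" using m H \<mu>(1)[of j] by (intro T.idx_eqI) auto
        ultimately have "f (\<alpha> (K j + 1)) = 0" unfolding f_def by simp
        moreover have "\<alpha> (K j + 1) \<notin> range \<mu>"
        proof
          assume "\<alpha> (K j + 1) \<in> range \<mu>"
          then have "\<alpha> (K j + 1) = \<mu> j" using i by (metis M.idx_self rangeE)
          with m show False by simp
        qed
        then have "f (\<alpha> (K j + 1 + int n)) = 0"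
          using ray_or_antiray[of "K j + 1"] f_\<mu> by (metis rangeE)
        ultimately show False using g1[of "K j + 1"] by simp
      qed
      then show ?thesis using K[of j] by simp
    qed
    then have "(\<Sum>j=1..n. T (int j + 1) - \<mu> (int j)) < (\<Sum>j=1..n. \<alpha> (K (int j) + 1) - \<alpha> (K (int j) + 1 - 1))"
      using n by (intro sum_strict_mono) auto
    then show False unfolding half sum_gaps[OF K] by simp
  qed
qed

lemma cnt_period: "cnt (k + 2 * int n) = cnt k"
proof -
  have e: "k + 2 * int n - 1 = k - 1 + 2 * int n" by simp
  have "int (cnt (k + 2 * int n)) = int (cnt k)"
    unfolding cnt e using idx_\<alpha>_shift[of k] idx_\<alpha>_shift[of "k - 1"] by simp
  then show ?thesis by simp
qed

lemma word_signature_eq: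
  assumes "occupancy_word n P v"
  shows "word_signature n v (res n k) = cnt k + cnt (k + int n)"
proof -
  have v: "v i = cnt (int i)" if "i \<in> {1..2 * n}" for i
    using assms that unfolding occupancy_word_iff cnt_def by blast
  \<comment> \<open>Each count has period 2n, but their sum only exchanges its summands under a
    shift by n. The interpretation supplies shifts by several periods.\<close>
  interpret periodic_pred "\<lambda>l. cnt l + cnt (l + int n) = cnt k + cnt (k + int n)" n
  proof
    show "(cnt (l + int n) + cnt (l + int n + int n) = cnt k + cnt (k + int n)) =
        (cnt l + cnt (l + int n) = cnt k + cnt (k + int n))" for l
      using cnt_period[of l] by (simp add: add_ac)
  qed (use T.N_pos in auto)
  let ?i = "res n k"
  have "?i \<in> {1..n}" by (rule res_in[OF T.N_pos])
  then have "word_signature n v ?i = cnt (int ?i) + cnt (int ?i + int n)"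
    unfolding word_signature_def using v[of ?i] v[of "?i + n"] by simp
  also have "\<dots> = cnt k + cnt (k + int n)"
    using period_mult[of k "- ((k - 1) div int n)"] int_res[OF T.N_pos, of k]
    by (simp add: mult.commute)
  finally show ?thesis .
qed

lemma interlacing_signature:
  assumes v: "occupancy_word n P v" "\<forall>i\<in>{1..2 * n}. v i \<in> {0, 1}"
  shows "interlacing n (word_signature n v)"
proof -
  have "word_signature n v (res n k) \<le> 2" for k
  proof -
    let ?i = "res n k"
    have "?i \<in> {1..n}" by (rule res_in[OF T.N_pos])
    then have "v ?i \<in> {0, 1}" "v (?i + n) \<in> {0, 1}" using v(2) by auto
    then show ?thesis unfolding word_signature_def by auto
  qed
  note iff = interlacing_iff_level[OF T.N_pos, of "word_signature n v", OF this]
  show ?thesis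
    unfolding iff word_signature_eq[OF v(1)]
    using g_period g_01 g_step ex_cnt_ne_1 by blast
qed

end

text \<open>The angles of the bisectors are reduced modulo pi, sorted and unrolled. Genericity
  enters three times: no line contains 1, so the reduced angles are nonzero; the lines are distinct,
  so n reduced angles remain; no line contains a point, so no \<open>T j\<close> is an
  \<open>\<alpha> k\<close>.\<close>

lemma generic_configE:
  assumes n: "n > 1" and ccw: "ccw_on_circle n P" and gen: "generic_position n P"
  obtains T \<alpha> where "generic_config T \<alpha> n P"
proof -
  have n0: "n > 0" using n by simp
  obtain \<theta> where \<theta>: "strict_mono_on {1..n} \<theta>" "\<theta> n < \<theta> 1 + 2 * pi" "\<And>i. i \<in> {1..n} \<Longrightarrow> P i = cis (\<theta> i)"
    using ccw unfolding ccw_on_circle_def by blast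
  define T where "T = periodic_ext n (2 * pi) \<theta>"
  interpret circle_points T n P
  proof (intro circle_points.intro circle_points_axioms.intro)
    show "periodic_seq T n (2 * pi)"
      unfolding T_def using n0 \<theta> by (intro periodic_seq_ext)
    show "P i = cis (T (int i))" if "i \<in> {1..n}" for i
      unfolding T_def using that \<theta>(3) by (simp add: periodic_ext_of_nat)
  qed (fact n)
  define \<beta> where "\<beta> i = \<mu> (int i) - of_int \<lfloor>\<mu> (int i) / pi\<rfloor> * pi" for i :: nat
  have \<beta>: "0 < \<beta> i \<and> \<beta> i < pi" if i: "i \<in> {1..n}" for i
  proof -
    have "of_int \<lfloor>\<mu> (int i) / pi\<rfloor> * pi \<le> \<mu> (int i)"
      by (simp flip: pos_le_divide_eq)
    moreover have "\<mu> (int i) < (of_int \<lfloor>\<mu> (int i) / pi\<rfloor> + 1) * pi"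
      by (subst pos_divide_less_eq[symmetric]) simp_all
    moreover have "\<beta> i \<noteq> 0"
    proof
      assume "\<beta> i = 0"
      then have "0 - \<mu> (int i) = of_int (- \<lfloor>\<mu> (int i) / pi\<rfloor>) * pi" unfolding \<beta>_def by simp
      then have "cis 0 \<in> ray_line (\<mu> (int i))" unfolding cis_mem_ray_line sin_zero_iff_int2 by blast
      then have "1 \<in> bisector_line n P i" using bisector_line[OF i] by simp
      then show False using gen i unfolding generic_position_def by blast
    qed
    ultimately show ?thesis unfolding \<beta>_def by (simp add: algebra_simps)
  qed
  have "inj_on \<beta> {1..n}"
  proof (rule inj_onI)
    fix i j assume ij: "i \<in> {1..n}" "j \<in> {1..n}" "\<beta> i = \<beta> j"
    then have "\<mu> (int i) - \<mu> (int j) = of_int (\<lfloor>\<mu> (int i) / pi\<rfloor> - \<lfloor>\<mu> (int j) / pi\<rfloor>) * pi"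
      unfolding \<beta>_def by (simp add: algebra_simps)
    then have "ray_line (\<mu> (int i)) = ray_line (\<mu> (int j))"
      unfolding ray_line_eq_iff sin_zero_iff_int2 by blast
    then have "bisector_line n P i = bisector_line n P j" using ij bisector_line by simp
    then show "i = j" using gen ij unfolding generic_position_def inj_on_def by blast
  qed
  then have "card (\<beta> ` {1..n}) = n" by (simp add: card_image)
  then obtain b where b: "strict_mono_on {1..n} b" "b ` {1..n} = \<beta> ` {1..n}"
    using ex_strict_mono_enumeration[of "\<beta> ` {1..n}" n] by auto
  have b_bounds: "0 < b i \<and> b i < pi" if "i \<in> {1..n}" for i
  proof -
    have "b i \<in> \<beta> ` {1..n}" using b(2) that by blast
    then show ?thesis using \<beta> by auto
  qed
  define \<alpha> where "\<alpha> = periodic_ext n pi b"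
  have \<alpha>_nat: "\<alpha> (int i) = b i" if "i \<in> {1..n}" for i
    unfolding \<alpha>_def using that by (rule periodic_ext_of_nat)
  interpret A: periodic_seq \<alpha> n pi
    unfolding \<alpha>_def
  proof (rule periodic_seq_ext[OF n0 b(1)])
    show "b n < b 1 + pi" using b_bounds[of n] b_bounds[of 1] n0 by simp
  qed
  interpret circle_config T \<alpha> n P
  proof unfold_locales
    have "\<alpha> 0 = b n - pi" using A.period[of 0] \<alpha>_nat[of n] n0 by simp
    then show "\<alpha> 0 < 0" using b_bounds[of n] n0 by simp
    show "0 < \<alpha> 1" using b_bounds[of 1] \<alpha>_nat[of 1] n0 by simp
  next
    fix j
    let ?i = "res n j"
    have i: "?i \<in> {1..n}" by (rule res_in[OF n0])
    then obtain l where l: "l \<in> {1..n}" "b l = \<beta> ?i" using b(2) by (metis imageE imageI)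
    define q where "q = (j - 1) div int n"
    define r where "r = \<lfloor>\<mu> (int ?i) / pi\<rfloor>"
    have "j = int ?i + q * int n" using int_res[OF n0, of j] unfolding q_def by simp
    then have "\<mu> j = \<mu> (int ?i) + of_int q * (2 * pi)" using \<mu>_add_mult[of "int ?i" q] by simp
    also have "\<dots> = \<beta> ?i + of_int (r + 2 * q) * pi"
      unfolding \<beta>_def r_def by (simp add: algebra_simps)
    also have "\<dots> = \<alpha> (int l + (r + 2 * q) * int n)"
      unfolding A.period_mult using l \<alpha>_nat by simp
    finally show "\<exists>k. \<mu> j = \<alpha> k" by blast
  next
    fix k
    let ?l = "res n k"
    have l: "?l \<in> {1..n}" by (rule res_in[OF n0])
    then obtain i where i: "i \<in> {1..n}" "b ?l = \<beta> i" using b(2) by (metis imageE imageI)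
    define q where "q = (k - 1) div int n"
    have "k = int ?l + q * int n" using int_res[OF n0, of k] unfolding q_def by simp
    then have "\<alpha> k = \<alpha> (int ?l) + of_int q * pi" using A.period_mult[of "int ?l" q] by simp
    also have "\<dots> = \<mu> (int i) + of_int (q - \<lfloor>\<mu> (int i) / pi\<rfloor>) * pi"
      using \<alpha>_nat[OF l] i unfolding \<beta>_def by (simp add: algebra_simps)
    finally show "\<exists>j. \<exists>t::int. \<alpha> k = \<mu> j + of_int t * pi" by blast
  qed
  have "generic_config T \<alpha> n P"
  proof unfold_locales
    fix j k
    show "T j \<noteq> \<alpha> k"
    proof
      assume "T j = \<alpha> k"
      let ?i = "res n j"
      have i: "?i \<in> {1..n}" by (rule res_in[OF n0])
      define q where "q = (j - 1) div int n"
      have "int ?i = j + (- q) * int n" using int_res[OF n0, of j] unfolding q_def by simp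
      then have "T (int ?i) = \<alpha> k + of_int (- 2 * q) * pi"
        using T.period_mult[of j "- q"] \<open>T j = \<alpha> k\<close> by simp
      also have "\<dots> = \<alpha> (k + (- 2 * q) * int n)" unfolding A.period_mult ..
      finally have "T (int ?i) \<in> range \<alpha>" by blast
      then have "\<exists>l\<in>{1..n}. P ?i \<in> bisector_line n P l"
        unfolding cis_mem_lines_iff[symmetric] P_eq[OF i] .
      then show False using gen i unfolding generic_position_def by blast
    qed
  qed
  then show thesis by (rule that)
qed

lemma realizable_imp_interlacing:
  assumes "n > 1" "\<forall>i\<in>{1..2 * n}. u i \<in> {0, 1}" "realizable n u"
  shows "interlacing n (word_signature n u)"
proof -
  obtain P where P: "ccw_on_circle n P" "generic_position n P" "occupancy_word n P u"
    using assms(3) unfolding realizable_def by blast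
  obtain T \<alpha> where "generic_config T \<alpha> n P" using generic_configE[OF assms(1) P(1,2)] by blast
  then interpret generic_config T \<alpha> n P .
  show ?thesis using P(3) assms(2) by (rule interlacing_signature)
qed

section \<open>Interlacing words are realizable\<close>

text \<open>Pigeonhole: n lines with distinct directions modulo pi, each a bisector, exhaust the n
  bisectors. The construction thus has to check only that every line is a bisector.\<close>

lemma (in circle_points) mid_rayI:
  assumes A: "periodic_seq \<alpha> n pi" and ray_mid: "\<And>k. \<exists>j. \<exists>t::int. \<alpha> k = \<mu> j + of_int t * pi"
  shows "\<exists>k. \<mu> j = \<alpha> k"
proof -
  interpret A: periodic_seq \<alpha> n pi by (fact A)
  obtain J t where Jt: "\<alpha> k = \<mu> (J k) + of_int (t k) * pi" for k :: int
    using ray_mid by metis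
  have \<mu>_res: "\<exists>m::int. \<mu> i = \<mu> j + of_int m * pi" if "res n i = res n j" for i j
  proof -
    have "int n dvd i - j" using that res_eq_iff[OF T.N_pos] by (simp add: mod_eq_dvd_iff)
    then obtain m where "i - j = int n * m" by blast
    then have "i = j + m * int n" by (simp add: algebra_simps)
    then have "\<mu> i = \<mu> j + of_int (2 * m) * pi" using \<mu>_add_mult[of j m] by simp
    then show ?thesis by blast
  qed
  let ?r = "\<lambda>k::nat. res n (J (int k))"
  have "inj_on ?r {1..n}"
  proof (rule inj_onI)
    fix k l assume kl: "k \<in> {1..n}" "l \<in> {1..n}" "?r k = ?r l"
    then obtain m :: int where "\<mu> (J (int k)) = \<mu> (J (int l)) + of_int m * pi" using \<mu>_res by blast
    then have "\<alpha> (int k) = \<alpha> (int l) + of_int (m + t (int k) - t (int l)) * pi"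
      using Jt[of "int k"] Jt[of "int l"] by (simp add: algebra_simps)
    also have "\<dots> = \<alpha> (int l + (m + t (int k) - t (int l)) * int n)" unfolding A.period_mult ..
    finally have "int k = int l + (m + t (int k) - t (int l)) * int n" by simp
    then have "res n (int k) = res n (int l)" by (metis res_add_mult)
    then show "k = l" using kl by (simp add: res_of_nat)
  qed
  then have "?r ` {1..n} = {1..n}"
    using res_in[OF T.N_pos] by (intro endo_inj_surj) auto
  moreover have "res n j \<in> {1..n}" by (rule res_in[OF T.N_pos])
  ultimately have "res n j \<in> ?r ` {1..n}" by (simp only:)
  then obtain k where "res n j = ?r k" by (rule imageE)
  then obtain m :: int where m: "\<mu> j = \<mu> (J (int k)) + of_int m * pi" using \<mu>_res by blast
  have "\<mu> j = \<alpha> (int k) + of_int (m - t (int k)) * pi"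
    using m Jt[of "int k"] by (simp add: algebra_simps)
  also have "\<dots> = \<alpha> (int k + (m - t (int k)) * int n)" unfolding A.period_mult ..
  finally show ?thesis by blast
qed

text \<open>Reduces realizability to positions on the real line with half turn \<open>W\<close>:
  \<open>Q k\<close> marks an occupied region, \<open>X k\<close> is its point, and
  \<open>a (k - 1)\<close>, \<open>a k\<close> are the lines around it. Each line must be midway
  between successive points, up to half turns.\<close>

lemma realizableI:
  fixes X a :: "int \<Rightarrow> real" and W :: real and Q :: "int \<Rightarrow> bool"
  assumes n: "n > 1" and per_Q: "\<And>k. Q (k + 2 * int n) \<longleftrightarrow> Q k"
    and card_Q: "card {k\<in>{1..2 * int n}. Q k} = n"
    and a: "periodic_seq a n W" and per_X: "\<And>k. X (k + 2 * int n) = X k + 2 * W"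
    and X_between: "\<And>k. Q k \<Longrightarrow> a (k - 1) < X k \<and> X k < a k"
    and mid: "\<And>k. \<exists>i j. \<exists>t::int. Q i \<and> Q j \<and> i < j \<and> (\<forall>l. i < l \<and> l < j \<longrightarrow> \<not> Q l) \<and>
      a k = (X i + X j) / 2 + of_int t * W"
    and v: "\<And>i. i \<in> {1..2 * n} \<Longrightarrow> v i = of_bool (Q (int i))"
  shows "realizable n v"
proof -
  interpret a: periodic_seq a n W by (fact a)
  \<comment> \<open>The angle 0 is put inside region 1, and \<open>r\<close> rescales the half turn
    from \<open>W\<close> to pi.\<close>
  define c where "c = (a 0 + a 1) / 2"
  define r where "r = pi / W"
  have r: "r > 0" "r * W = pi" unfolding r_def using a.c_pos by simp_all
  have n0: "n > 0" using n by simp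
  define \<alpha> where "\<alpha> k = r * (a k - c)" for k
  have \<alpha>_less: "r * (x - c) < r * (y - c) \<longleftrightarrow> x < y" for x y using r(1) by simp
  interpret A: periodic_seq \<alpha> n pi
  proof
    show "strict_mono \<alpha>" using r(1) unfolding \<alpha>_def by (intro strict_monoI) simp
    show "\<alpha> (j + int n) = \<alpha> j + pi" for j
      unfolding \<alpha>_def a.period using r(2) by (simp add: algebra_simps)
  qed (fact n0)
  obtain e where e: "strict_mono_on {1..n} e" "e ` {1..n} = {k\<in>{1..2 * int n}. Q k}"
  proof -
    have "finite {k\<in>{1..2 * int n}. Q k}" by (rule finite_subset[of _ "{1..2 * int n}"]) auto
    from ex_strict_mono_enumeration[OF this card_Q] that show thesis by blast
  qed
  have e_in: "e i \<in> {1..2 * int n} \<and> Q (e i)" if "i \<in> {1..n}" for i using e(2) that by blast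
  define E where "E = periodic_ext n (2 * int n) e"
  have E_mono: "strict_mono E"
    unfolding E_def using e_in[of 1] e_in[of n] n0 e(1) by (intro strict_mono_periodic_ext) auto
  have E_per: "E (j + int n) = E j + 2 * int n" for j
    unfolding E_def by (rule periodic_ext_add[OF n0])
  have per_Q_mult: "Q (k + m * (2 * int n)) \<longleftrightarrow> Q k" for k m
    by (rule periodic_pred.period_mult[of Q "2 * n", simplified])
       (use n0 per_Q e_in[of 1] in \<open>unfold_locales; force\<close>)
  have Q_E: "Q (E j)" for j
  proof -
    have "E j = e (res n j) + ((j - 1) div int n) * (2 * int n)"
      unfolding E_def periodic_ext_def by (simp add: mult.commute)
    then show ?thesis using per_Q_mult e_in[OF res_in[OF n0]] by metis
  qed
  have ex_E: "\<exists>j. k = E j" if "Q k" for k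
  proof -
    define q where "q = (k - 1) div int (2 * n)"
    have k: "k = int (res (2 * n) k) + q * (2 * int n)"
      using int_res[of "2 * n" k] n0 unfolding q_def by simp
    then have "Q (int (res (2 * n) k))" using that per_Q_mult by metis
    moreover have "res (2 * n) k \<in> {1..2 * n}" using n0 by (intro res_in) simp
    ultimately have "int (res (2 * n) k) \<in> e ` {1..n}" unfolding e(2) by auto
    then obtain i where i: "i \<in> {1..n}" "int (res (2 * n) k) = e i" by blast
    interpret E: periodic_seq "\<lambda>j. real_of_int (E j)" n "2 * real n"
      using n0 E_mono by unfold_locales (auto simp: strict_mono_def E_per)
    have "real_of_int (E (int i + q * int n)) = real_of_int (E (int i)) + of_int q * (2 * real n)"
      by (rule E.period_mult)
    also have "E (int i) = e i" unfolding E_def using i(1) by (rule periodic_ext_of_nat)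
    also have "real_of_int (e i) + of_int q * (2 * real n) = of_int k" using k i(2) by simp
    finally show ?thesis by (metis of_int_eq_iff)
  qed
  define T where "T j = r * (X (E j) - c)" for j
  have XE: "a (E j - 1) < X (E j)" "X (E j) < a (E j)" for j using X_between[OF Q_E] by auto
  interpret TP: periodic_seq T n "2 * pi"
  proof
    show "strict_mono T"
    proof (rule strict_mono_intI)
      fix j
      have "E j < E (j + 1)" using E_mono by (simp add: strict_mono_def)
      then have "a (E j) \<le> a (E (j + 1) - 1)" by simp
      then have "X (E j) < X (E (j + 1))"
        using XE(2)[of j] XE(1)[of "j + 1"] by (meson less_le_trans less_trans)
      then show "T j < T (j + 1)" unfolding T_def \<alpha>_less .
    qed
    show "T (j + int n) = T j + 2 * pi" for j
      unfolding T_def E_per per_X using r(2) by (simp add: algebra_simps)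
  qed (fact n0)
  define P where "P i = cis (T (int i))" for i :: nat
  interpret circle_points T n P
    by unfold_locales (use n in \<open>auto simp: P_def\<close>)
  have ray_mid: "\<exists>j. \<exists>t::int. \<alpha> k = \<mu> j + of_int t * pi" for k
  proof -
    obtain i j and t :: int where ij: "Q i" "Q j" "i < j" "\<And>l. i < l \<Longrightarrow> l < j \<Longrightarrow> \<not> Q l"
      and ak: "a k = (X i + X j) / 2 + of_int t * W" using mid[of k] by blast
    obtain p where p: "i = E p" using ex_E ij(1) by blast
    have "j = E (p + 1)"
    proof -
      obtain q where q: "j = E q" using ex_E ij(2) by blast
      have "p < q" using ij(3) E_mono unfolding p q by (simp add: strict_mono_less)
      have "\<not> E (p + 1) < E q"
        using ij(4)[of "E (p + 1)"] Q_E[of "p + 1"] E_mono unfolding p q by (auto simp: strict_mono_less)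
      then have "q = p + 1" using \<open>p < q\<close> E_mono by (simp add: strict_mono_less)
      then show ?thesis using q by simp
    qed
    have "\<alpha> k = r * ((X i + X j) / 2 - c) + of_int t * (r * W)"
      unfolding \<alpha>_def ak by (simp add: algebra_simps)
    also have "r * ((X i + X j) / 2 - c) = \<mu> p"
      unfolding \<mu>_def T_def p[symmetric] \<open>j = E (p + 1)\<close>[symmetric] by (simp add: field_simps)
    finally show ?thesis unfolding r(2) by blast
  qed
  have between: "\<not> (a k < x \<and> x < a l)" if "a (i - 1) < x" "x < a i" "\<not> (k < i \<and> i \<le> l)" for x i k l
  proof
    assume H: "a k < x \<and> x < a l"
    then have "a k < a i" "a (i - 1) < a l" using that(1,2) less_trans by blast+
    then have "k < i" "i - 1 < l" by simp_all
    then show False using that(3) by simp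
  qed
  interpret generic_config T \<alpha> n P
  proof unfold_locales
    have "a 0 < c" "c < a 1" using a.less_iff[of 0 1] unfolding c_def by auto
    then show "\<alpha> 0 < 0" "0 < \<alpha> 1" unfolding \<alpha>_def using r(1) by (simp_all add: mult_pos_neg)
    show "\<exists>k. \<mu> j = \<alpha> k" for j using A.periodic_seq_axioms ray_mid by (rule mid_rayI)
    show "\<exists>j. \<exists>t::int. \<alpha> k = \<mu> j + of_int t * pi" for k by (rule ray_mid)
    show "T j \<noteq> \<alpha> k" for j k
    proof
      assume "T j = \<alpha> k"
      then have "X (E j) = a k" unfolding T_def \<alpha>_def using r(1) by simp
      then have "a (E j - 1) < a k" "a k < a (E j)" using XE[of j] by simp_all
      then show False by simp
    qed
  qed
  have "occupancy_word n P v"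
    unfolding occupancy_word_iff
  proof
    fix i assume i: "i \<in> {1..2 * n}"
    have "\<alpha> (int i - 1) < T j \<and> T j < \<alpha> (int i) \<longleftrightarrow> E j = int i" for j
    proof
      assume "\<alpha> (int i - 1) < T j \<and> T j < \<alpha> (int i)"
      then have "a (int i - 1) < X (E j) \<and> X (E j) < a (int i)" unfolding T_def \<alpha>_def \<alpha>_less .
      then show "E j = int i" using between[OF XE, of "int i - 1" j "int i"] by linarith
    next
      assume "E j = int i"
      then show "\<alpha> (int i - 1) < T j \<and> T j < \<alpha> (int i)"
        unfolding T_def \<alpha>_def \<alpha>_less using XE[of j] by simp
    qed
    then have "{j. \<alpha> (int i - 1) < T j \<and> T j < \<alpha> (int i)} = {j. E j = int i}" by simp
    moreover have "card {j. E j = int i} = of_bool (Q (int i))"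
    proof (cases "Q (int i)")
      case True
      then obtain j where "int i = E j" using ex_E by blast
      then have "{j. E j = int i} = {j}" using E_mono by (auto simp: strict_mono_eq)
      then show ?thesis using True by simp
    next
      case False
      have "E j \<noteq> int i" for j
      proof
        assume "E j = int i"
        then show False using Q_E[of j] False by simp
      qed
      then have "{j. E j = int i} = {}" by simp
      then show ?thesis using False by simp
    qed
    ultimately show "v i = card {j. \<alpha> (int i - 1) < T j \<and> T j < \<alpha> (int i)}"
      using v[OF i] by simp
  qed
  moreover have "ccw_on_circle n P"
    unfolding ccw_on_circle_def
  proof (intro exI conjI ballI)
    show "strict_mono_on {1..n} (\<lambda>i. T (int i))" by (rule strict_mono_onI) simp
    have "T (int n) < T (1 + int n)" by simp
    then show "T (int n) < T (int 1) + 2 * pi" unfolding TP.period by simp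
  qed (simp add: P_def)
  ultimately show ?thesis unfolding realizable_def using generic_position by blast
qed

section \<open>Placing the points of an interlacing word in clusters\<close>

definition pw :: "int \<Rightarrow> real" where
  "pw d = 4 ^ nat d"

lemma pw_ge_1: "1 \<le> pw d"
  unfolding pw_def by simp

lemma pw_mono: "d \<le> e \<Longrightarrow> pw d \<le> pw e"
  unfolding pw_def by (intro power_increasing) auto

lemma pw_Suc: "0 \<le> d \<Longrightarrow> pw (d + 1) = 4 * pw d"
  unfolding pw_def by (simp add: nat_add_distrib)

lemma pw_less: "0 \<le> d \<Longrightarrow> d < e \<Longrightarrow> 4 * pw d \<le> pw e"
  using pw_mono[of "d + 1" e] pw_Suc[of d] by simp

text \<open>An interlacing word in unrolled form: \<open>Q\<close> is the word with period 2n,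
  \<open>g\<close> its level with period n.\<close>

locale level_word =
  fixes n :: nat and Q :: "int \<Rightarrow> bool" and g :: "int \<Rightarrow> int"
  assumes n_ge_3: "n \<ge> 3"
    and Q_period: "Q (k + 2 * int n) \<longleftrightarrow> Q k"
    and g_period: "g (k + int n) = g k"
    and g_01: "g k \<in> {0, 1}"
    and g_step: "g k = g (k - 1) + of_bool (Q k) + of_bool (Q (k + int n)) - 1"
    and ex_double: "\<exists>k. Q k \<and> Q (k + int n)"
begin

lemma n_pos: "n > 0" using n_ge_3 by simp

definition R :: "int \<Rightarrow> bool" where "R k \<longleftrightarrow> Q (k + int n)"

definition double :: "int \<Rightarrow> bool" where "double k \<longleftrightarrow> Q k \<and> R k"

lemma R_shift: "R (k + int n) \<longleftrightarrow> Q k"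
  unfolding R_def using Q_period[of k] by (simp add: algebra_simps)

lemma step: "g k = g (k - 1) + of_bool (Q k) + of_bool (R k) - 1"
  unfolding R_def by (rule g_step)

sublocale D: periodic_pred double n
proof
  show "double (k + int n) = double k" for k
    unfolding double_def R_shift by (auto simp: R_def)
  show "\<exists>k. double k" using ex_double unfolding double_def R_def .
qed (rule n_pos)

sublocale S: periodic_pred Q "2 * n"
proof
  show "Q (k + int (2 * n)) = Q k" for k using Q_period[of k] by simp
  show "\<exists>k. Q k" using ex_double by blast
qed (use n_pos in simp)

lemma g_cases: "g k = 0 \<or> g k = 1" using g_01[of k] by simp

lemma rise_iff: "g (k - 1) = 0 \<and> g k = 1 \<longleftrightarrow> double k"
  using step[of k] g_cases[of k] g_cases[of "k - 1"] unfolding double_def by auto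

lemma ex_double_between: "g k = 0 \<Longrightarrow> g l = 1 \<Longrightarrow> k < l \<Longrightarrow> \<exists>m. k < m \<and> m \<le> l \<and> double m"
  using ex_step_between[of g 0 1 k l, OF g_01] rise_iff by auto

text \<open>The centre of the cluster of \<open>k\<close>: the preceding letter 2 while the level is
  1, the coming one while it is 0. A letter 0 is thus attached to the next cluster, but carries no
  point.\<close>

definition Z :: "int \<Rightarrow> int" where
  "Z k = (if g k = 1 then D.last_le k else D.next_gt k)"

lemma double_Z: "double (Z k)"
  unfolding Z_def using D.last_le D.next_gt by simp

lemma Z_1: "g k = 1 \<Longrightarrow> Z k \<le> k" "g k = 1 \<Longrightarrow> k - int n < Z k"
  unfolding Z_def using D.last_le[of k] by auto

lemma Z_0: "g k = 0 \<Longrightarrow> k < Z k" "g k = 0 \<Longrightarrow> Z k \<le> k + int n"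
  unfolding Z_def using D.next_gt[of k] by auto

lemma Z_double: "double k \<Longrightarrow> Z k = k"
proof -
  assume "double k"
  then have "g k = 1" "D.last_le k = k" using rise_iff[of k] by (auto intro: D.last_le_eqI)
  then show ?thesis unfolding Z_def by simp
qed

lemma Z_add: "Z (k + int n) = Z k + int n"
  unfolding Z_def g_period D.last_le_add D.next_gt_add by simp

lemma Z_mono: "k \<le> l \<Longrightarrow> Z k \<le> Z l"
proof -
  assume "k \<le> l"
  consider "k = l" | "k < l" "g k = 1" "g l = 1" | "k < l" "g k = 1" "g l = 0"
    | "k < l" "g k = 0" "g l = 1" | "k < l" "g k = 0" "g l = 0"
    using \<open>k \<le> l\<close> g_cases[of k] g_cases[of l] by force
  then show ?thesis
  proof cases
    case 2
    then show ?thesis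
      unfolding Z_def using D.last_le[of k] D.last_le_max[of "D.last_le k" l] by simp
  next
    case 3
    then show ?thesis using Z_1[of k] Z_0[of l] by simp
  next
    case 4
    then obtain m where "k < m" "m \<le> l" "double m" using ex_double_between by blast
    then show ?thesis
      unfolding Z_def using 4 D.next_gt_min[of m k] D.last_le_max[of m l] by simp
  next
    case 5
    then show ?thesis
      unfolding Z_def using D.next_gt[of l] D.next_gt_min[of "D.next_gt l" k] by simp
  qed simp
qed

text \<open>
  The offset \<open>h\<close> separates the two points of a letter 2, by a distance depending on the letter:
  otherwise the two lines between neighbouring clusters \<open>2\<close>, \<open>2\<close> without letters 1 could coincide.
\<close>

definition h :: "int \<Rightarrow> real" where
  "h z = (if even (z div int n) then 0 else 1 / (2 + of_int (z mod int n)))"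

lemma h_bounds: "0 \<le> h z" "h z < 1"
proof -
  have "0 \<le> z mod int n" using n_pos by simp
  then have "(0::real) \<le> of_int (z mod int n)" by simp
  then show "0 \<le> h z" "h z < 1" unfolding h_def by (auto simp: divide_simps)
qed

text \<open>The quotients of \<open>z\<close> and \<open>z + n\<close> differ in parity while the
  remainders agree, so one offset is 0 and the other is the fraction. The summand 2 keeps it below
  1.\<close>

lemma h_diff: "\<bar>h z - h (z + int n)\<bar> = 1 / (2 + of_int (z mod int n))"
proof -
  have "0 \<le> z mod int n" using n_pos by simp
  then have "(0::real) \<le> of_int (z mod int n)" by simp
  then show ?thesis unfolding h_def using n_pos by simp
qed

lemma h_add: "h (z + 2 * int n) = h z"
proof -
  have "(z + 2 * int n) div int n = z div int n + 2" "(z + 2 * int n) mod int n = z mod int n"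
    using n_pos by simp_all
  then show ?thesis unfolding h_def by simp
qed

text \<open>With growth factor 4, a point lies before the midpoint of any nearer and any farther
  position on its side. The factor 2 on the left breaks the mirror symmetry, which would allow equal
  gaps on both sides of a letter 0.\<close>

definition off :: "int \<Rightarrow> real" where
  "off k = (if Z k < k then pw (k - Z k) else if k < Z k then - 2 * pw (Z k - k) else h k)"

text \<open>Positions stay within \<open>2 * pw n\<close> of their centres, and different centres
  are at least \<open>L\<close> apart. The factor 16 lets the gap between clusters dominate every
  distance inside one.\<close>

definition L :: real where "L = 16 * pw (int n)"

definition W :: real where "W = L * real n"

text \<open>
  \<open>X k\<close> is the position of the point in region \<open>k\<close> if there is one, in units making the half turn
  equal to \<open>W\<close>; \<open>Y k\<close> is that of the point in the opposite region, moved back by the half turn.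
\<close>

definition X :: "int \<Rightarrow> real" where "X k = L * of_int (Z k) + off k"

definition Y :: "int \<Rightarrow> real" where "Y k = X (k + int n) - W"

text \<open>Stands for either strand, so that each estimate below serves points of one strand as
  well as comparisons across strands.\<close>

definition pos_at :: "int \<Rightarrow> real \<Rightarrow> bool" where
  "pos_at k y \<longleftrightarrow> y = X k \<or> y = Y k"

lemma pos_at_X [simp]: "pos_at k (X k)" and pos_at_Y [simp]: "pos_at k (Y k)"
  unfolding pos_at_def by auto

lemma Y_eq: "Y k = L * of_int (Z k) + off (k + int n)"
  unfolding Y_def X_def Z_add W_def by (simp add: algebra_simps)

lemma Z_add2: "Z (k + 2 * int n) = Z k + 2 * int n"
  using Z_add[of k] Z_add[of "k + int n"] by (simp add: algebra_simps)

lemma X_add: "X (k + 2 * int n) = X k + 2 * W"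
  unfolding X_def off_def Z_add2 h_add W_def by (simp add: algebra_simps)

lemma pos_at_right: "pos_at k y \<Longrightarrow> Z k < k \<Longrightarrow> y = L * of_int (Z k) + pw (k - Z k)"
  unfolding pos_at_def Y_eq by (auto simp: X_def off_def Z_add)

lemma pos_at_left: "pos_at k y \<Longrightarrow> k < Z k \<Longrightarrow> y = L * of_int (Z k) - 2 * pw (Z k - k)"
  unfolding pos_at_def Y_eq by (auto simp: X_def off_def Z_add)

lemma pos_at_center:
  assumes "pos_at k y" "Z k = k"
  shows "L * of_int (Z k) \<le> y" "y < L * of_int (Z k) + 1"
  using assms h_bounds[of k] h_bounds[of "k + int n"]
  unfolding pos_at_def Y_eq by (auto simp: X_def off_def Z_add)

lemma pos_at_bounds:
  assumes "pos_at k y"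
  shows "L * of_int (Z k) - 2 * pw (int n) \<le> y" "y \<le> L * of_int (Z k) + pw (int n)"
proof -
  have "Z k < k \<or> Z k = k \<or> k < Z k" by linarith
  moreover have "k - Z k \<le> int n" "Z k - k \<le> int n"
    using g_cases[of k] Z_1[of k] Z_0[of k] by auto
  then have "pw (k - Z k) \<le> pw (int n)" "pw (Z k - k) \<le> pw (int n)" by (auto intro: pw_mono)
  ultimately show "L * of_int (Z k) - 2 * pw (int n) \<le> y" "y \<le> L * of_int (Z k) + pw (int n)"
    using pos_at_right[OF assms] pos_at_left[OF assms] pos_at_center[OF assms]
      pw_ge_1[of "int n"] pw_ge_1[of "k - Z k"] pw_ge_1[of "Z k - k"] by force+
qed

lemma L_step: "z < z' \<Longrightarrow> L * of_int z + L \<le> L * of_int z'"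
proof -
  assume "z < z'"
  then have "L * of_int (z + 1) \<le> L * of_int z'"
    unfolding L_def using pw_ge_1[of "int n"] by (intro mult_left_mono) auto
  then show ?thesis by (simp add: algebra_simps)
qed

lemma pos_at_less:
  assumes "pos_at k y" "pos_at l y'" "k < l"
  shows "y < y'"
proof (cases "Z k = Z l")
  case True
  define z where "z = Z k"
  have z: "Z k = z" "Z l = z" using True unfolding z_def by auto
  consider "z < k" | "z = k" | "k < z" "z < l" | "k < z" "z = l" | "l < z"
    using assms(3) by linarith
  then show ?thesis
  proof cases
    case 1
    then show ?thesis
      using pos_at_right[OF assms(1)] pos_at_right[OF assms(2)] assms(3) z pw_less[of "k - z" "l - z"]
        pw_ge_1[of "k - z"] by simp
  next
    case 2
    then show ?thesis
      using pos_at_center[OF assms(1)] pos_at_right[OF assms(2)] assms(3) z pw_ge_1[of "l - z"] by simp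
  next
    case 3
    then show ?thesis
      using pos_at_left[OF assms(1)] pos_at_right[OF assms(2)] z pw_ge_1[of "z - k"] pw_ge_1[of "l - z"] by simp
  next
    case 4
    then show ?thesis
      using pos_at_left[OF assms(1)] pos_at_center[OF assms(2)] z pw_ge_1[of "z - k"] by simp
  next
    case 5
    then show ?thesis
      using pos_at_left[OF assms(1)] pos_at_left[OF assms(2)] assms(3) z pw_less[of "z - l" "z - k"]
        pw_ge_1[of "z - l"] by simp
  qed
next
  case False
  then have "Z k < Z l" using Z_mono[of k l] assms(3) by simp
  then show ?thesis
    using L_step[of "Z k" "Z l"] pos_at_bounds[OF assms(1)] pos_at_bounds[OF assms(2)] pw_ge_1[of "int n"]
    unfolding L_def by linarith
qed

section \<open>Midpoints on the two strands and the lines they define\<close>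

definition pQ :: "int \<Rightarrow> int" where "pQ k = S.last_le k"
definition nQ :: "int \<Rightarrow> int" where "nQ k = S.next_gt k"
definition pR :: "int \<Rightarrow> int" where "pR k = S.last_le (k + int n) - int n"
definition nR :: "int \<Rightarrow> int" where "nR k = S.next_gt (k + int n) - int n"

lemma pQ: "Q (pQ k)" "pQ k \<le> k" "Q j \<Longrightarrow> j \<le> k \<Longrightarrow> j \<le> pQ k"
  unfolding pQ_def using S.last_le[of k] S.last_le_max by auto

lemma nQ: "Q (nQ k)" "k < nQ k" "Q j \<Longrightarrow> k < j \<Longrightarrow> nQ k \<le> j"
  unfolding nQ_def using S.next_gt[of k] S.next_gt_min by auto

lemma pR: "R (pR k)" "pR k \<le> k" "R j \<Longrightarrow> j \<le> k \<Longrightarrow> j \<le> pR k"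
  unfolding pR_def R_def using S.last_le[of "k + int n"] S.last_le_max[of "j + int n" "k + int n"] by auto

lemma nR: "R (nR k)" "k < nR k" "R j \<Longrightarrow> k < j \<Longrightarrow> nR k \<le> j"
  unfolding nR_def R_def using S.next_gt[of "k + int n"] S.next_gt_min[of "j + int n" "k + int n"] by auto

definition mQ :: "int \<Rightarrow> real" where "mQ k = (X (pQ k) + X (nQ k)) / 2"
definition mR :: "int \<Rightarrow> real" where "mR k = (Y (pR k) + Y (nR k)) / 2"

lemma mR_eq: "mR k = mQ (k + int n) - W"
  unfolding mR_def mQ_def Y_def pR_def nR_def pQ_def nQ_def by (simp add: field_simps)

lemma mQ_add2: "mQ (k + 2 * int n) = mQ k + 2 * W"
proof -
  have "pQ (k + 2 * int n) = pQ k + 2 * int n" "nQ (k + 2 * int n) = nQ k + 2 * int n"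
    unfolding pQ_def nQ_def using S.last_le_add[of k] S.next_gt_add[of k] by simp_all
  then show ?thesis unfolding mQ_def by (simp add: X_add add_divide_distrib)
qed

lemma mQ_shift: "mQ (k + int n) = mR k + W" and mR_shift: "mR (k + int n) = mQ k + W"
  unfolding mR_eq using mQ_add2[of k] by (simp_all add: algebra_simps)

text \<open>
  In state \<open>g k = 0\<close> the bisecting rays of both strands lie before the next points, and the \<open>k\<close>th
  line is the last of them; in state \<open>g k = 1\<close> both are still to come, and it is the first of them.
\<close>

definition a :: "int \<Rightarrow> real" where
  "a k = (if g k = 0 then max (mQ k) (mR k) else min (mQ k) (mR k))"

lemma a_shift: "a (k + int n) = a k + W"
  unfolding a_def g_period mQ_shift mR_shift by (auto simp: max_def min_def)

text \<open>Measured from the centre, \<open>x\<close> is less than \<open>2 * pw (k - Z k)\<close>,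
  while \<open>y\<close> is nonnegative and \<open>y'\<close> at least
  \<open>4 * pw (k - Z k)\<close>, in the same cluster by growth and in a later one by the size of
  \<open>L\<close>.\<close>

lemma less_midpoint:
  assumes "g k = 1" "pos_at k x"
    and that: "pos_at i y" "pos_at j y'" "Z k \<le> i" "i \<le> k" "k < j"
  shows "x < (y + y') / 2"
proof -
  define z where "z = Z k"
  have Zz: "Z z = z" unfolding z_def by (rule Z_double[OF double_Z])
  have "Z i = z" using Z_mono[of z i] Z_mono[of i k] that Zz unfolding z_def by simp
  have zk: "z \<le> k" "k - z < int n" using Z_1[of k] assms(1) unfolding z_def by auto
  have y: "L * of_int z \<le> y"
  proof (cases "i = z")
    case True
    then show ?thesis using pos_at_center[OF that(1)] \<open>Z i = z\<close> by simp
  next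
    case False
    then have "Z i < i" using \<open>Z i = z\<close> that(3) unfolding z_def by simp
    then show ?thesis using pos_at_right[OF that(1)] \<open>Z i = z\<close> pw_ge_1[of "i - z"] by simp
  qed
  have "4 * pw (k - z) \<le> pw (int n)" using zk by (intro pw_less) auto
  have y': "L * of_int z + 4 * pw (k - z) \<le> y'"
  proof (cases "Z j = z")
    case True
    then have "y' = L * of_int z + pw (j - z)" using pos_at_right[OF that(2)] zk that(5) by simp
    then show ?thesis using pw_less[of "k - z" "j - z"] zk that(5) by simp
  next
    case False
    then have "z < Z j" using Z_mono[of k j] that(5) unfolding z_def by simp
    then show ?thesis
      using L_step[of z "Z j"] pos_at_bounds[OF that(2)] \<open>4 * pw (k - z) \<le> pw (int n)\<close> pw_ge_1[of "int n"]
      unfolding L_def by linarith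
  qed
  have "x < L * of_int z + 2 * pw (k - z)"
  proof (cases "k = z")
    case True
    then show ?thesis using pos_at_center[OF assms(2)] pw_ge_1[of "k - z"] unfolding z_def by simp
  next
    case False
    then show ?thesis using pos_at_right[OF assms(2)] zk pw_ge_1[of "k - z"] unfolding z_def by simp
  qed
  then have "2 * x < y + y'" using y y' by linarith
  then show ?thesis by simp
qed

text \<open>The mirror image: from the centre, \<open>x\<close> is at least
  \<open>- 2 * pw (Z k - k)\<close>, while \<open>y\<close> is at most
  \<open>- 8 * pw (Z k - k)\<close> and \<open>y'\<close> less than 1.\<close>

lemma midpoint_less:
  assumes "g (k - 1) = 0" "Q k \<or> R k" "pos_at k x"
    and that: "pos_at i y" "pos_at j y'" "i < k" "k \<le> j" "j \<le> Z k"
  shows "(y + y') / 2 < x"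
proof -
  define z where "z = Z k"
  have Zz: "Z z = z" unfolding z_def by (rule Z_double[OF double_Z])
  have "k \<le> z"
    unfolding z_def using that by simp
  \<comment> \<open>Searching from \<open>k - 1\<close> instead of \<open>k\<close> gains the unit
    that makes the bound strict, hence \<open>4 * pw (z - k) \<le> pw n\<close>.\<close>
  have "z - k < int n"
  proof (cases "double k")
    case True
    then show ?thesis using Z_double n_pos unfolding z_def by simp
  next
    case False
    then have "g k = 0" using assms(1) rise_iff[of k] g_cases[of k] by auto
    have "z = D.next_gt k" unfolding z_def Z_def using \<open>g k = 0\<close> by simp
    moreover have "D.next_gt (k - 1) \<noteq> k" using False D.next_gt(1)[of "k - 1"] by auto
    then have "k < D.next_gt (k - 1)" using D.next_gt(2)[of "k - 1"] by simp
    ultimately have "z \<le> D.next_gt (k - 1)" using D.next_gt_min[OF D.next_gt(1)] by simp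
    then show ?thesis using D.next_gt(3)[of "k - 1"] by simp
  qed
  have "Z j = z" using Z_mono[of k j] Z_mono[of j z] that Zz unfolding z_def by simp
  have y': "y' < L * of_int z + 1"
  proof (cases "j = z")
    case True
    then show ?thesis using pos_at_center[OF that(2)] \<open>Z j = z\<close> by simp
  next
    case False
    then show ?thesis
      using pos_at_left[OF that(2)] \<open>Z j = z\<close> that(5) pw_ge_1[of "z - j"] unfolding z_def by simp
  qed
  have "4 * pw (z - k) \<le> pw (int n)" using \<open>k \<le> z\<close> \<open>z - k < int n\<close> by (intro pw_less) auto
  have y: "y \<le> L * of_int z - 8 * pw (z - k)"
  proof (cases "Z i = z")
    case True
    then have "y = L * of_int z - 2 * pw (z - i)" using pos_at_left[OF that(1)] that(3) \<open>k \<le> z\<close> by simp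
    then show ?thesis using pw_less[of "z - k" "z - i"] that(3) \<open>k \<le> z\<close> by simp
  next
    case False
    then have "Z i < z" using Z_mono[of i k] that(3) unfolding z_def by simp
    then show ?thesis
      using L_step[of "Z i" z] pos_at_bounds[OF that(1)] \<open>4 * pw (z - k) \<le> pw (int n)\<close> pw_ge_1[of "int n"]
      unfolding L_def by linarith
  qed
  have "L * of_int z - 2 * pw (z - k) \<le> x"
  proof (cases "k = z")
    case True
    then show ?thesis using pos_at_center[OF assms(3)] pw_ge_1[of "z - k"] unfolding z_def by simp
  next
    case False
    then show ?thesis using pos_at_left[OF assms(3)] \<open>k \<le> z\<close> unfolding z_def by simp
  qed
  then have "y + y' < 2 * x" using y y' pw_ge_1[of "z - k"] by linarith
  then show ?thesis by simp
qed

text \<open>On its own strand the point is an endpoint of the midpoint's interval, so order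
  suffices. The other strand's midpoint matters only where \<open>a\<close> is a minimum after the
  point or a maximum before it, and there the two preceding estimates apply.\<close>

lemma X_between:
  assumes "Q k"
  shows "a (k - 1) < X k" "X k < a k"
proof -
  have R_Z: "R (Z l)" for l using double_Z[of l] unfolding double_def by simp
  show "X k < a k"
  proof -
    have "pQ k = k" using pQ(2)[of k] pQ(3)[of k k] assms by simp
    then have 1: "X k < mQ k" unfolding mQ_def using pos_at_less[of k "X k" "nQ k" "X (nQ k)"] nQ[of k] by simp
    have "X k < mR k" if "g k = 1"
      unfolding mR_def using that pR(2)[of k] nR(2)[of k] pR(3)[OF R_Z, of k] Z_1[of k]
      by (intro less_midpoint[of k _ "pR k" _ "nR k"]) auto
    with 1 show ?thesis unfolding a_def using g_cases[of k] by auto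
  qed
  show "a (k - 1) < X k"
  proof -
    have "nQ (k - 1) = k" using nQ(2)[of "k - 1"] nQ(3)[of k "k - 1"] assms by simp
    then have 1: "mQ (k - 1) < X k"
      unfolding mQ_def using pos_at_less[of "pQ (k - 1)" "X (pQ (k - 1))" k "X k"] pQ(2)[of "k - 1"] by simp
    have "mR (k - 1) < X k" if g: "g (k - 1) = 0"
    proof -
      have "k \<le> Z k"
        using Z_double[of k] rise_iff[of k] g g_cases[of k] Z_0[of k] by force
      then have "nR (k - 1) \<le> Z k" using nR(3)[OF R_Z, of "k - 1" k] by simp
      then show ?thesis
        unfolding mR_def using g assms pR(2)[of "k - 1"] nR(2)[of "k - 1"]
        by (intro midpoint_less[of k _ "pR (k - 1)" _ "nR (k - 1)"]) auto
    qed
    with 1 show ?thesis unfolding a_def using g_cases[of "k - 1"] by auto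
  qed
qed

section \<open>Gaps at the ends of clusters and distinctness of the lines\<close>

lemma pos_at_diff_right:
  assumes "pos_at k y" "pos_at i y'" "Z k \<le> i" "i < k"
  shows "3 * pw (k - Z k - 1) \<le> y - y'" "y - y' \<le> 4 * pw (k - Z k - 1)"
proof -
  define z where "z = Z k"
  have Zz: "Z z = z" unfolding z_def by (rule Z_double[OF double_Z])
  have "Z i = z" using Z_mono[of z i] Z_mono[of i k] assms Zz unfolding z_def by simp
  have y: "y = L * of_int z + 4 * pw (k - z - 1)"
    using pos_at_right[OF assms(1)] assms pw_Suc[of "k - z - 1"] unfolding z_def by simp
  \<comment> \<open>With d = \<open>k - z - 1\<close>, the outer point is \<open>4 * pw d\<close>
    from the centre and the inner one at most \<open>pw d\<close>, on the same side.\<close>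
  have "L * of_int z \<le> y' \<and> y' \<le> L * of_int z + pw (k - z - 1)"
  proof (cases "i = z")
    case True
    then show ?thesis using pos_at_center[OF assms(2)] \<open>Z i = z\<close> pw_ge_1[of "k - z - 1"] by simp
  next
    case False
    then show ?thesis
      using pos_at_right[OF assms(2)] \<open>Z i = z\<close> assms pw_ge_1[of "i - z"] pw_mono[of "i - z" "k - z - 1"]
      unfolding z_def by simp
  qed
  then show "3 * pw (k - Z k - 1) \<le> y - y'" "y - y' \<le> 4 * pw (k - Z k - 1)"
    using y unfolding z_def by linarith+
qed

lemma pos_at_diff_left:
  assumes "pos_at k y" "pos_at j y'" "k < j" "j \<le> Z k"
  shows "6 * pw (Z k - k - 1) \<le> y' - y" "y' - y < 8 * pw (Z k - k - 1) + 1"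
proof -
  define z where "z = Z k"
  have Zz: "Z z = z" unfolding z_def by (rule Z_double[OF double_Z])
  have "Z j = z" using Z_mono[of k j] Z_mono[of j z] assms Zz unfolding z_def by simp
  have y: "y = L * of_int z - 8 * pw (z - k - 1)"
    using pos_at_left[OF assms(1)] assms pw_Suc[of "z - k - 1"] unfolding z_def by simp
  have "L * of_int z - 2 * pw (z - k - 1) \<le> y' \<and> y' < L * of_int z + 1"
  proof (cases "j = z")
    case True
    then show ?thesis using pos_at_center[OF assms(2)] \<open>Z j = z\<close> pw_ge_1[of "z - k - 1"] by simp
  next
    case False
    then show ?thesis
      using pos_at_left[OF assms(2)] \<open>Z j = z\<close> assms pw_ge_1[of "z - j"] pw_mono[of "z - j" "z - k - 1"]
      unfolding z_def by simp
  qed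
  then show "6 * pw (Z k - k - 1) \<le> y' - y" "y' - y < 8 * pw (Z k - k - 1) + 1"
    using y unfolding z_def by linarith+
qed

lemma center_diff:
  assumes "Z k = k"
  shows "\<bar>X k - Y k\<bar> = 1 / (2 + of_int (k mod int n))"
  using assms h_diff[of k] unfolding X_def Y_eq off_def Z_add by simp

text \<open>Here \<open>k\<close> ends a cluster just before a letter 0. Either it is the letter 2
  itself, or exactly one strand has a point at \<open>k\<close> and the other strand's last point is
  nearer to the centre.\<close>

lemma right_gap:
  assumes "g k = 1" "g (k + 1) = 0"
  shows "Z k = k \<and> \<bar>X (pQ k) - Y (pR k)\<bar> = 1 / (2 + of_int (k mod int n)) \<or>
    Z k < k \<and> 3 * pw (k - Z k - 1) \<le> \<bar>X (pQ k) - Y (pR k)\<bar> \<and>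
      \<bar>X (pQ k) - Y (pR k)\<bar> \<le> 4 * pw (k - Z k - 1)"
proof -
  have D: "Q (Z k)" "R (Z k)" using double_Z unfolding double_def by auto
  have zk: "Z k \<le> k" using Z_1 assms by simp
  have i: "Z k \<le> pQ k" "pQ k \<le> k" "Z k \<le> pR k" "pR k \<le> k"
    using pQ pR D zk by auto
  show ?thesis
  proof (cases "Z k = k")
    case True
    then have "pQ k = k" "pR k = k" using i by auto
    then show ?thesis using center_diff[OF True] True by simp
  next
    case False
    then have "\<not> double k" using Z_double by blast
    moreover have "Q k \<or> R k" using step[of k] assms(1) g_cases[of "k - 1"]
      by (auto simp: of_bool_def split: if_splits)
    ultimately consider "Q k" "\<not> R k" | "R k" "\<not> Q k" unfolding double_def by blast
    then show ?thesis
    proof cases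
      case 1
      then have "pQ k = k" "pR k \<noteq> k" using pQ(2,3)[of k] pQ(3)[of k k] pR(1)[of k] by force+
      then show ?thesis
        using pos_at_diff_right[of k "X k" "pR k" "Y (pR k)"] i False zk pw_ge_1[of "k - Z k - 1"] by simp
    next
      case 2
      then have "pR k = k" "pQ k \<noteq> k" using pR(2,3)[of k] pR(3)[of k k] pQ(1)[of k] by force+
      then show ?thesis
        using pos_at_diff_right[of k "Y k" "pQ k" "X (pQ k)"] i False zk pw_ge_1[of "k - Z k - 1"] by simp
    qed
  qed
qed

lemma left_gap:
  assumes "g (k - 1) = 0"
  shows "Z k = k \<and> \<bar>X (nQ (k - 1)) - Y (nR (k - 1))\<bar> = 1 / (2 + of_int (k mod int n)) \<or>
    k < Z k \<and> 6 * pw (Z k - k - 1) \<le> \<bar>X (nQ (k - 1)) - Y (nR (k - 1))\<bar> \<and>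
      \<bar>X (nQ (k - 1)) - Y (nR (k - 1))\<bar> < 8 * pw (Z k - k - 1) + 1"
proof -
  have D: "Q (Z k)" "R (Z k)" using double_Z unfolding double_def by auto
  have zk: "k \<le> Z k"
    using Z_double[of k] rise_iff[of k] assms g_cases[of k] Z_0[of k] by force
  have j: "k \<le> nQ (k - 1)" "nQ (k - 1) \<le> Z k" "k \<le> nR (k - 1)" "nR (k - 1) \<le> Z k"
    using nQ(2)[of "k - 1"] nQ(3)[of "Z k" "k - 1"] nR(2)[of "k - 1"] nR(3)[of "Z k" "k - 1"] D zk by auto
  show ?thesis
  proof (cases "Z k = k")
    case True
    then have "nQ (k - 1) = k" "nR (k - 1) = k" using j by auto
    then show ?thesis using center_diff[OF True] True by simp
  next
    case False
    then have "\<not> double k" using Z_double by blast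
    moreover have "Q k \<or> R k" using step[of k] assms(1) g_cases[of k]
      by (auto simp: of_bool_def split: if_splits)
    ultimately consider "Q k" "\<not> R k" | "R k" "\<not> Q k" unfolding double_def by blast
    then show ?thesis
    proof cases
      case 1
      then have "nQ (k - 1) = k" "nR (k - 1) \<noteq> k" using nQ(3)[of k "k - 1"] nR(1)[of "k - 1"] j by force+
      then show ?thesis
        using pos_at_diff_left[of k "X k" "nR (k - 1)" "Y (nR (k - 1))"] j False zk pw_ge_1[of "Z k - k - 1"] by simp
    next
      case 2
      then have "nR (k - 1) = k" "nQ (k - 1) \<noteq> k" using nR(3)[of k "k - 1"] nQ(1)[of "k - 1"] j by force+
      then show ?thesis
        using pos_at_diff_left[of k "Y k" "nQ (k - 1)" "X (nQ (k - 1))"] j False zk pw_ge_1[of "Z k - k - 1"] by simp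
    qed
  qed
qed

text \<open>Equal midpoints would make the gap between the strands before the letter 0 equal to the
  one after it. Fractions below 1 cannot match cluster distances, and two of either kind are told
  apart by residues or by their ranges.\<close>

lemma mQ_ne_mR:
  assumes "g k = 1" "g (k + 1) = 0"
  shows "mQ k \<noteq> mR k"
proof
  assume "mQ k = mR k"
  have QR: "\<not> Q (k + 1)" "\<not> R (k + 1)" using step[of "k + 1"] assms
    by (auto simp: of_bool_def split: if_splits)
  have n1: "nQ (k + 1) = nQ k" "nR (k + 1) = nR k"
  proof -
    have "nQ k \<noteq> k + 1" "nR k \<noteq> k + 1" using QR nQ(1)[of k] nR(1)[of k] by metis+
    then have "k + 1 < nQ k" "k + 1 < nR k" using nQ(2)[of k] nR(2)[of k] by simp_all
    then have "nQ (k + 1) \<le> nQ k" "nR (k + 1) \<le> nR k" using nQ(1,3) nR(1,3) by blast+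
    moreover have "nQ k \<le> nQ (k + 1)" "nR k \<le> nR (k + 1)"
      using nQ(3)[OF nQ(1)[of "k + 1"], of k] nQ(2)[of "k + 1"]
        nR(3)[OF nR(1)[of "k + 1"], of k] nR(2)[of "k + 1"] by auto
    ultimately show "nQ (k + 1) = nQ k" "nR (k + 1) = nR k" by auto
  qed
  define A B where "A = \<bar>X (pQ k) - Y (pR k)\<bar>" and "B = \<bar>X (nQ k) - Y (nR k)\<bar>"
  have "A = B"
    using \<open>mQ k = mR k\<close> unfolding mQ_def mR_def A_def B_def by (simp add: abs_if)
  have frac: "1 / (2 + of_int (l mod int n)) < (1::real)" for l
  proof -
    have "0 \<le> l mod int n" using n_pos by simp
    then have "(0::real) \<le> of_int (l mod int n)" by simp
    then show ?thesis by simp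
  qed
  define d d' where "d = k - Z k - 1" and "d' = Z (k + 2) - (k + 2) - 1"
  have A: "Z k = k \<and> A = 1 / (2 + of_int (k mod int n)) \<or> Z k < k \<and> 3 * pw d \<le> A \<and> A \<le> 4 * pw d"
    using right_gap[OF assms] unfolding A_def d_def .
  have B: "Z (k + 2) = k + 2 \<and> B = 1 / (2 + of_int ((k + 2) mod int n)) \<or>
      k + 2 < Z (k + 2) \<and> 6 * pw d' \<le> B \<and> B < 8 * pw d' + 1"
    using left_gap[of "k + 2"] assms(2) n1 unfolding B_def d'_def by (simp add: add.commute)
  from A B show False
  proof (elim disjE conjE)
    assume "A = 1 / (2 + of_int (k mod int n))" "B = 1 / (2 + of_int ((k + 2) mod int n))"
    then have "(2 + of_int (k mod int n) :: real) = 2 + of_int ((k + 2) mod int n)"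
      using \<open>A = B\<close> by simp
    then have "(k + 2) mod int n = k mod int n" by simp
    \<comment> \<open>Impossible as n \<ge> 3; for n = 2 both centres would be the same
      letter.\<close>
    then have "int n dvd 2" by (simp add: mod_eq_dvd_iff)
    then have "int n \<le> 2" by (rule zdvd_imp_le) simp
    then show False using n_ge_3 by simp
  next
    assume "A = 1 / (2 + of_int (k mod int n))" "6 * pw d' \<le> B"
    then show False using \<open>A = B\<close> frac[of k] pw_ge_1[of d'] by simp
  next
    assume "3 * pw d \<le> A" "B = 1 / (2 + of_int ((k + 2) mod int n))"
    then show False using \<open>A = B\<close> frac[of "k + 2"] pw_ge_1[of d] by simp
  next
    assume H: "Z k < k" "3 * pw d \<le> A" "A \<le> 4 * pw d" "k + 2 < Z (k + 2)" "6 * pw d' \<le> B" "B < 8 * pw d' + 1"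
    have dd: "0 \<le> d" "0 \<le> d'" using H unfolding d_def d'_def by auto
    show False
    \<comment> \<open>If d \<le> d' then \<open>4 * pw d < 6 * pw d'\<close>; otherwise
      \<open>3 * pw d \<ge> 12 * pw d' > 8 * pw d' + 1\<close>.\<close>
    proof (cases "d \<le> d'")
      case True
      then show ?thesis using pw_mono[of d d'] pw_ge_1[of d] H \<open>A = B\<close> by linarith
    next
      case False
      then show ?thesis using pw_less[of d' d] dd pw_ge_1[of d'] H \<open>A = B\<close> by linarith
    qed
  qed
qed

text \<open>A point in region \<open>k + 1\<close> or in the opposite one separates the two lines.
  At a letter 0 both lines come from the same pair of midpoints, first as minimum, then as
  maximum.\<close>

lemma a_step: "a k < a (k + 1)"
proof -
  consider "Q (k + 1)" | "Q (k + 1 + int n)" | "\<not> Q (k + 1)" "\<not> R (k + 1)" unfolding R_def by blast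
  then show ?thesis
  proof cases
    case 1
    then show ?thesis using X_between[of "k + 1"] by simp
  next
    case 2
    have "k + 1 + int n - 1 = k + int n" by simp
    then have "a (k + int n) < a (k + 1 + int n)"
      using X_between[OF 2] by simp
    then show ?thesis unfolding a_shift by simp
  next
    case 3
    then have g: "g k = 1" "g (k + 1) = 0"
      using step[of "k + 1"] g_cases[of k] g_cases[of "k + 1"] by auto
    have "pQ (k + 1) = pQ k" "pR (k + 1) = pR k" "nQ (k + 1) = nQ k" "nR (k + 1) = nR k"
    proof -
      have "pQ (k + 1) \<noteq> k + 1" "pR (k + 1) \<noteq> k + 1" "nQ k \<noteq> k + 1" "nR k \<noteq> k + 1"
        using 3 pQ(1)[of "k + 1"] pR(1)[of "k + 1"] nQ(1)[of k] nR(1)[of k] by metis+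
      then have "pQ (k + 1) \<le> k" "pR (k + 1) \<le> k" "k + 1 < nQ k" "k + 1 < nR k"
        using pQ(2)[of "k + 1"] pR(2)[of "k + 1"] nQ(2)[of k] nR(2)[of k] by simp_all
      then have "pQ (k + 1) \<le> pQ k" "pR (k + 1) \<le> pR k" "nQ (k + 1) \<le> nQ k" "nR (k + 1) \<le> nR k"
        using pQ(1,3) pR(1,3) nQ(1,3) nR(1,3) by blast+
      moreover have "pQ k \<le> pQ (k + 1)" "pR k \<le> pR (k + 1)" "nQ k \<le> nQ (k + 1)" "nR k \<le> nR (k + 1)"
        using pQ(3)[OF pQ(1)[of k], of "k + 1"] pQ(2)[of k] pR(3)[OF pR(1)[of k], of "k + 1"] pR(2)[of k]
          nQ(3)[OF nQ(1)[of "k + 1"], of k] nQ(2)[of "k + 1"] nR(3)[OF nR(1)[of "k + 1"], of k] nR(2)[of "k + 1"]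
        by auto
      ultimately show "pQ (k + 1) = pQ k" "pR (k + 1) = pR k" "nQ (k + 1) = nQ k" "nR (k + 1) = nR k" by auto
    qed
    then have "mQ (k + 1) = mQ k" "mR (k + 1) = mR k" unfolding mQ_def mR_def by simp_all
    then show ?thesis unfolding a_def using g mQ_ne_mR[OF g] by auto
  qed
qed

text \<open>The level returns after a half turn, so the n letters of the signature sum to n.\<close>

lemma card_Q: "card {k\<in>{1..2 * int n}. Q k} = n"
proof -
  have "(\<Sum>i=1..m. (of_bool (Q (int i)) + of_bool (Q (int i + int n)) :: int)) = g (int m) - g 0 + int m" for m
  proof (induction m)
    case (Suc m)
    then show ?case using g_step[of "int (Suc m)"] by simp
  qed simp
  from this[of n] have "(\<Sum>i=1..n. of_bool (Q (int i))) + (\<Sum>i=1..n. of_bool (Q (int i + int n))) = int n"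
    using g_period[of 0] by (simp add: sum.distrib)
  also have "(\<Sum>i=1..n. of_bool (Q (int i + int n))) = (\<Sum>i=n+1..2*n. (of_bool (Q (int i)) :: int))"
    using sum.shift_bounds_cl_nat_ivl[of "\<lambda>i. of_bool (Q (int i)) :: int" 1 n n] by (simp add: mult_2)
  also have "(\<Sum>i=1..n. of_bool (Q (int i))) + \<dots> = (\<Sum>i=1..2*n. (of_bool (Q (int i)) :: int))"
    using sum.ub_add_nat[of 1 n "\<lambda>i. of_bool (Q (int i)) :: int" n] by (simp add: mult_2)
  also have "\<dots> = int (card {i\<in>{1..2*n}. Q (int i)})"
    by (simp add: of_bool_def sum.If_cases Int_def)
  also have "card {i\<in>{1..2*n}. Q (int i)} = card (int ` {i\<in>{1..2*n}. Q (int i)})"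
    by (simp add: card_image)
  also have "int ` {i\<in>{1..2*n}. Q (int i)} = {k\<in>{1..2 * int n}. Q k}"
  proof (intro equalityI subsetI)
    fix k assume "k \<in> {k\<in>{1..2 * int n}. Q k}"
    then show "k \<in> int ` {i\<in>{1..2*n}. Q (int i)}" by (intro image_eqI[of _ _ "nat k"]) auto
  qed auto
  finally show ?thesis by simp
qed

lemma a_mid:
  "\<exists>i j. \<exists>t::int. Q i \<and> Q j \<and> i < j \<and> (\<forall>l. i < l \<and> l < j \<longrightarrow> \<not> Q l) \<and>
    a k = (X i + X j) / 2 + of_int t * W"
proof -
  have mQ: "\<exists>i j. Q i \<and> Q j \<and> i < j \<and> (\<forall>l. i < l \<and> l < j \<longrightarrow> \<not> Q l) \<and> mQ k = (X i + X j) / 2" for k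
  proof (rule exI[of _ "pQ k"], rule exI[of _ "nQ k"], intro conjI allI impI)
    show "\<not> Q l" if "pQ k < l \<and> l < nQ k" for l
      using that pQ(3)[of l k] nQ(3)[of l k] by (cases "l \<le> k") auto
    show "pQ k < nQ k" using pQ(2)[of k] nQ(2)[of k] by simp
  qed (auto simp: pQ nQ mQ_def)
  have "a k = mQ k + of_int 0 * W \<or> a k = mQ (k + int n) + of_int (- 1) * W"
    unfolding a_def mR_eq by (auto simp: max_def min_def)
  then show ?thesis using mQ[of k] mQ[of "k + int n"] by metis
qed

lemma periodic_a: "periodic_seq a n W"
  by unfold_locales (auto intro: strict_mono_intI a_step a_shift n_pos)

end

lemma interlacing_imp_realizable:
  assumes n: "n \<ge> 3" and u: "\<forall>i\<in>{1..2 * n}. u i \<in> {0, 1}"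
    and int: "interlacing n (word_signature n u)"
  shows "realizable n u"
proof -
  have n0: "n > 0" "2 * n > 0" using n by simp_all
  define Q where "Q k \<longleftrightarrow> u (res (2 * n) k) = 1" for k
  have uQ: "u (res (2 * n) k) = of_bool (Q k)" for k
    using u res_in[OF n0(2), of k] unfolding Q_def by auto
  have Q2: "Q (k + m * (2 * int n)) \<longleftrightarrow> Q k" for k m
    unfolding Q_def using res_add_mult[of "2 * n" k m] by simp
  have sig: "word_signature n u (res n k) = of_bool (Q k) + of_bool (Q (k + int n))" for k
  proof -
    let ?i = "res n k"
    have i: "?i \<in> {1..n}" by (rule res_in[OF n0(1)])
    have "u ?i = of_bool (Q (int ?i))" "u (?i + n) = of_bool (Q (int ?i + int n))"
      using uQ[of "int ?i"] uQ[of "int (?i + n)"] res_of_nat[of ?i "2 * n"] res_of_nat[of "?i + n" "2 * n"] i by auto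
    moreover have "of_bool (Q (int ?i)) + of_bool (Q (int ?i + int n)) = (of_bool (Q k) + of_bool (Q (k + int n)) :: nat)"
    proof -
      define q where "q = (k - 1) div int n"
      have k: "int ?i = k - q * int n" using int_res[OF n0(1), of k] unfolding q_def by (simp add: mult.commute)
      show ?thesis
      \<comment> \<open>An odd number of half turns between \<open>k\<close> and its representative
        exchanges the two summands.\<close>
      proof (cases "even q")
        case True
        then obtain r where "q = 2 * r" by blast
        then have "int ?i = k + (- r) * (2 * int n)" "int ?i + int n = k + int n + (- r) * (2 * int n)"
          using k by (simp_all add: algebra_simps)
        then have "Q (int ?i) = Q k" "Q (int ?i + int n) = Q (k + int n)" by (simp_all only: Q2)
        then show ?thesis by simp
      next
        case False
        then obtain r where "q = 2 * r + 1" by (rule oddE)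
        then have "int ?i = k + int n + (- r - 1) * (2 * int n)" "int ?i + int n = k + (- r) * (2 * int n)"
          using k by (simp_all add: algebra_simps)
        then have "Q (int ?i) = Q (k + int n)" "Q (int ?i + int n) = Q k" by (simp_all only: Q2)
        then show ?thesis by simp
      qed
    qed
    ultimately show ?thesis unfolding word_signature_def by simp
  qed
  have le: "word_signature n u (res n k) \<le> 2" for k unfolding sig by simp
  obtain g :: "int \<Rightarrow> int" where g: "\<And>k. g (k + int n) = g k" "\<And>k. g k \<in> {0, 1}"
    "\<And>k. g k = g (k - 1) + int (word_signature n u (res n k)) - 1"
    using int unfolding interlacing_iff_level[of n "word_signature n u", OF n0(1) le] by metis
  obtain k2 where "word_signature n u (res n k2) = 2"
    using int unfolding interlacing_iff_int[OF n0(1)] by blast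
  interpret level_word n Q g
  proof
    show "g k = g (k - 1) + of_bool (Q k) + of_bool (Q (k + int n)) - 1" for k
      using g(3)[of k] unfolding sig by simp
    show "Q (k + 2 * int n) = Q k" for k using Q2[of k 1] by simp
    show "\<exists>k. Q k \<and> Q (k + int n)"
      using \<open>word_signature n u (res n k2) = 2\<close> unfolding sig by (intro exI[of _ k2]) (auto simp: of_bool_def split: if_splits)
  qed (use n g(1,2) in blast)+
  show ?thesis
  proof (rule realizableI[of n Q a W X])
    show "u i = of_bool (Q (int i))" if "i \<in> {1..2 * n}" for i
      using uQ[of "int i"] that by (simp add: res_of_nat)
  qed (use n Q_period card_Q periodic_a X_add X_between a_mid in auto)
qed

theorem theorem1:
  fixes n :: nat and u :: "nat \<Rightarrow> nat"
  assumes "n \<ge> 3"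
    and "\<forall>i\<in>{1..2 * n}. u i \<in> {0, 1}"
  shows "realizable n u \<longleftrightarrow> interlacing n (word_signature n u)"
  using realizable_imp_interlacing[of n u] interlacing_imp_realizable[of n u] assms by auto

end
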